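(* Let $p$ be a prime, $K$ a finite field of characteristic $p$ with an automorphism $\eta$ of order $2$, let $q$ be the order of the fixed field of $\eta$ (so $|K|=q^2$), and let $T\colon K\to\mathbf F_p$ be the trace map. Let $V$ be a nonzero finite-dimensional $K$-vector space, of $\mathbf F_p$-dimension $2n$, $F\colon V\times V\to K$ a nondegenerate $\eta$-Hermitian form, $\lambda\in K$ with $\lambda\ne\lambda^\eta$, and $f(u,v)=T(\lambda F(u,v))$ for $u,v\in V$. Let $\rho\colon E(f)\to\mathrm{GL}(V')$ be an absolutely irreducible representation of degree $p^n$ over a field $K'$, and let $\sigma$ be the associated factor set on $G(f)$. For $g\in G(f)$ put $i(g)=\dim_K I(g)$ and $\mu(g)=(-q)^{-i(g)}\in K'$. Then $\mu$ splits $\sigma$, i.e. $$\sigma(g,h)=\mu(g)\mu(h)\mu(gh)^{-1}\qquad\text{for all }g,h\in G(f),$$ and $\mu(g)=\mu(g^{-1})^{\eta'}$ for all $g\in G(f)$ and every automorphism $\eta'$ of $K'$ inverting $\epsilon$.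
   Context: Linear maps act on the right. An $\eta$-Hermitian form is linear in the first variable, $\eta$-semilinear in the second, and satisfies $F(y,x)=F(x,y)^\eta$. $f^{\mathrm t}(x,y)=f(y,x)$; here $f-f^{\mathrm t}$ is nondegenerate. $E(f)$ is the extraspecial group $V\times\mathbf F_p$ with multiplication $(x_1,z_1)(x_2,z_2)=(x_1+x_2,z_1+z_2+f(x_1,x_2))$. $G(f)$ is the group of all $K$-linear $g\in\mathrm{GL}(V)$ with $f(xg,yg)=f(x,y)$ for all $x,y\in V$. For $g\in G(f)$, $I(g)$ is the image of $1-g$ on $V$. The central element $(0,1)$ acts under $\rho$ as a scalar $\epsilon\in K'$, a primitive $p$-th root of unity (so the characteristic of $K'$ is not $p$). For $g\in G(f)$ define $$s(g)=|V|^{-1}\sum_{y\in V}\rho(y,0)\rho(yg,0)^{-1};$$ each $s(g)$ is invertible, and the factor set $\sigma\colon G(f)\times G(f)\to K'\setminus\{0\}$ is defined by $s(g)s(h)=\sigma(g,h)s(gh)$. *)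

theory Defs
  imports
    "HOL-Algebra.Algebraic_Closure_Type"
    "HOL-Library.Function_Algebras"
    "Berlekamp_Zassenhaus.Finite_Field"
begin

subsection \<open>Fields\<close>

definition field_automorphism :: "('a::field \<Rightarrow> 'a) \<Rightarrow> bool" where
  "field_automorphism h \<longleftrightarrow> bij h \<and> h 1 = 1 \<and>
     (\<forall>x y. h (x + y) = h x + h y) \<and> (\<forall>x y. h (x * y) = h x * h y)"

text \<open>The field of order \<open>p\<close> is the type \<open>'p mod_ring\<close> with \<open>p = CARD('p)\<close>. The following map
  embeds it in a field of characteristic \<open>p\<close>; in any other characteristic it is not a
  homomorphism.\<close>

definition prime_field_emb :: "'p::prime_card mod_ring \<Rightarrow> 'k::field" where
  "prime_field_emb a = of_int (to_int_mod_ring a)"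

text \<open>The absolute trace, as the sum of the conjugates \<open>x ^ (p ^ i)\<close> with \<open>i < [K : F\<^sub>p]\<close>; this sum
  lies in the prime field.\<close>

definition abs_trace :: "'k::{field,finite} \<Rightarrow> 'p::prime_card mod_ring" where
  "abs_trace x =
     (THE t. prime_field_emb t =
        (\<Sum>i<vector_space.dim (\<lambda>(a::'p mod_ring) (y::'k). prime_field_emb a * y) UNIV.
           x ^ (CARD('p) ^ i)))"


subsection \<open>Forms and groups\<close>

definition hermitian_form ::
    "('k::field \<Rightarrow> 'v::ab_group_add \<Rightarrow> 'v) \<Rightarrow> ('k \<Rightarrow> 'k) \<Rightarrow> ('v \<Rightarrow> 'v \<Rightarrow> 'k) \<Rightarrow> bool" where
  "hermitian_form scale \<eta> F \<longleftrightarrow>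
     (\<forall>y. Vector_Spaces.linear scale (*) (\<lambda>x. F x y)) \<and>
     (\<forall>x y z. F x (y + z) = F x y + F x z) \<and>
     (\<forall>x c y. F x (scale c y) = \<eta> c * F x y) \<and>
     (\<forall>x y. F y x = \<eta> (F x y))"

definition nondegenerate_form :: "('v::zero \<Rightarrow> 'v \<Rightarrow> 'k::zero) \<Rightarrow> bool" where
  "nondegenerate_form F \<longleftrightarrow>
     (\<forall>x. (\<forall>y. F x y = 0) \<longrightarrow> x = 0) \<and> (\<forall>y. (\<forall>x. F x y = 0) \<longrightarrow> y = 0)"

definition extraspecial_group ::
    "('v::ab_group_add \<Rightarrow> 'v \<Rightarrow> 'f::ab_group_add) \<Rightarrow> ('v \<times> 'f) monoid" where
  "extraspecial_group f =
     \<lparr>carrier = UNIV,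
      monoid.mult = (\<lambda>(x1, z1) (x2, z2). (x1 + x2, z1 + z2 + f x1 x2)),
      monoid.one = (0, 0)\<rparr>"

text \<open>Linear maps act on the right, so the product of \<open>g\<close> and \<open>h\<close> is \<open>g\<close> followed by \<open>h\<close>, that is
  \<open>fcomp g h = (\<lambda>x. h (g x))\<close>.\<close>

definition general_linear :: "('k::field \<Rightarrow> 'v::ab_group_add \<Rightarrow> 'v) \<Rightarrow> ('v \<Rightarrow> 'v) monoid" where
  "general_linear scale =
     \<lparr>carrier = {g. Vector_Spaces.linear scale scale g \<and> bij g},
      monoid.mult = fcomp, monoid.one = id\<rparr>"

definition isometry_group ::
    "('k::field \<Rightarrow> 'v::ab_group_add \<Rightarrow> 'v) \<Rightarrow> ('v \<Rightarrow> 'v \<Rightarrow> 'f) \<Rightarrow> ('v \<Rightarrow> 'v) monoid" where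
  "isometry_group scale f =
     (general_linear scale)
       \<lparr>carrier := {g \<in> carrier (general_linear scale). \<forall>x y. f (g x) (g y) = f x y}\<rparr>"

definition image_one_minus :: "('v::ab_group_add \<Rightarrow> 'v) \<Rightarrow> 'v set" where
  "image_one_minus g = range (\<lambda>x. x - g x)"


subsection \<open>Absolutely irreducible representations\<close>

definition irreducible_on ::
    "('l::field \<Rightarrow> 'w::ab_group_add \<Rightarrow> 'w) \<Rightarrow> 'w set \<Rightarrow> ('w \<Rightarrow> 'w) set \<Rightarrow> bool" where
  "irreducible_on scale W A \<longleftrightarrow>
     W \<noteq> {0} \<and>
     (\<forall>U. module.subspace scale U \<and> U \<subseteq> W \<and> (\<forall>a\<in>A. a ` U \<subseteq> U) \<longrightarrow> U = {0} \<or> U = W)"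

text \<open>The scalar extension to the algebraic closure, in coordinates: if \<open>B\<close> is a finite basis of a
  space over \<open>L\<close>, the extended space consists of the functions from \<open>B\<close> to the algebraic closure of
  \<open>L\<close> (extended by \<open>0\<close> outside \<open>B\<close>), where \<open>\<phi>\<close> stands for the sum of all \<open>b \<otimes> \<phi> b\<close>; an
  endomorphism \<open>a\<close> acts by its matrix with respect to \<open>B\<close>.\<close>

definition ext_space :: "'w set \<Rightarrow> ('w \<Rightarrow> 'l::field alg_closure) set" where
  "ext_space B = {\<phi>. \<forall>b. b \<notin> B \<longrightarrow> \<phi> b = 0}"

definition ext_map ::
    "('l::field \<Rightarrow> 'w::ab_group_add \<Rightarrow> 'w) \<Rightarrow> 'w set \<Rightarrow> ('w \<Rightarrow> 'w) \<Rightarrow>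
     ('w \<Rightarrow> 'l alg_closure) \<Rightarrow> 'w \<Rightarrow> 'l alg_closure" where
  "ext_map scale B a \<phi> =
     (\<lambda>c. \<Sum>b\<in>B. \<phi> b * to_ac (module.representation scale B (a b) c))"

text \<open>Absolutely irreducible means irreducible over the algebraic closure. The choice of the basis
  is immaterial.\<close>

definition absolutely_irreducible ::
    "('l::field \<Rightarrow> 'w::ab_group_add \<Rightarrow> 'w) \<Rightarrow> 'e monoid \<Rightarrow> ('e \<Rightarrow> 'w \<Rightarrow> 'w) \<Rightarrow> bool" where
  "absolutely_irreducible scale E \<rho> \<longleftrightarrow>
     (\<exists>B. finite_dimensional_vector_space scale B \<and>
        irreducible_on (\<lambda>k \<phi> b. k * \<phi> b) (ext_space B :: ('w \<Rightarrow> 'l alg_closure) set)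
          ((\<lambda>x. ext_map scale B (\<rho> x)) ` carrier E))"


subsection \<open>The factor set\<close>

text \<open>In this section \<open>scale'\<close> is the scalar multiplication of the representation space, \<open>\<rho>\<close> a
  representation of the extraspecial group, and \<open>g\<close>, \<open>h\<close> are isometries.\<close>

definition weil_op ::
    "('l::field \<Rightarrow> 'w::ab_group_add \<Rightarrow> 'w) \<Rightarrow> ('v::ab_group_add \<times> 'f::ab_group_add \<Rightarrow> 'w \<Rightarrow> 'w) \<Rightarrow>
     ('v \<Rightarrow> 'v) \<Rightarrow> 'w \<Rightarrow> 'w" where
  "weil_op scale' \<rho> g =
     (\<lambda>w. scale' (inverse (of_nat CARD('v)))
       (\<Sum>y\<in>UNIV.
          (\<rho> (y, 0) \<otimes>\<^bsub>general_linear scale'\<^esub> inv\<^bsub>general_linear scale'\<^esub> (\<rho> (g y, 0))) w))"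

definition factor_set ::
    "('l::field \<Rightarrow> 'w::ab_group_add \<Rightarrow> 'w) \<Rightarrow> ('v::ab_group_add \<times> 'f::ab_group_add \<Rightarrow> 'w \<Rightarrow> 'w) \<Rightarrow>
     ('v \<Rightarrow> 'v) \<Rightarrow> ('v \<Rightarrow> 'v) \<Rightarrow> 'l" where
  "factor_set scale' \<rho> g h =
     (THE c. c \<noteq> 0 \<and>
        fcomp (weil_op scale' \<rho> g) (weil_op scale' \<rho> h) =
        (\<lambda>w. scale' c (weil_op scale' \<rho> (fcomp g h) w)))"

definition central_scalar ::
    "('l::field \<Rightarrow> 'w::ab_group_add \<Rightarrow> 'w) \<Rightarrow> ('v::ab_group_add \<times> 'f::{ab_group_add,one} \<Rightarrow> 'w \<Rightarrow> 'w) \<Rightarrow> 'l"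
  where
  "central_scalar scale' \<rho> = (THE e. \<rho> (0, 1) = scale' e)"

end

theory Submission
  imports Defs "HOL-Library.Product_Plus"
begin

text \<open>By Schur's lemma the centre acts through a nontrivial character \<open>\<theta>\<close> of the prime field, so
  \<open>\<rho> (x, 0) \<rho> (y, 0) = \<theta> (f x y) \<rho> (x + y, 0)\<close>. Expanding \<open>s g * s h\<close>, a change of variables shows
  that the coefficients vanish off the image of \<open>1 - g h\<close> and are there determined by the
  coefficient at \<open>0\<close>; hence \<open>s g * s h\<close> is a multiple of \<open>s (g h)\<close>. The coefficient at \<open>0\<close> is the
  Gauss sum of a skew-Hermitian form on the space of all \<open>(y, z)\<close> with \<open>y (1 - g) + z (1 - h) = 0\<close>.
  Over \<open>\<eta>\<close>, a Gauss sum on a space with \<open>q ^ (2 m)\<close> elements and radical of \<open>q ^ (2 d)\<close> elements is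
  \<open>(- q) ^ (m + d)\<close>, since it is \<open>- q\<close> in the anisotropic one-dimensional case. The radical is
  computed from the fixed spaces of \<open>g\<close>, \<open>h\<close> and \<open>g h\<close>, using \<open>(I(g) \<inter> I(h))\<^sup>\<bottom> = ker (1 - g) + ker (1 - h)\<close>.
  For the last claim, \<open>I(g\<^sup>-\<^sup>1) = I(g)\<close> and automorphisms of \<open>K'\<close> fix the prime field.\<close>

subsection \<open>Counting in finite vector spaces\<close>

text \<open>The Gauss sum of a quadratic form depends on its discriminant as well as on its rank.
  Here the norm maps the units of K onto the units of the fixed field with all fibres of size q + 1,
  so every nonzero one-dimensional skew-Hermitian form has the same Gauss sum 1 - (q + 1) = - q, and
  the coefficient at 0 becomes a matter of counting. One dimension in this count, that of I(g)
  \<inter> I(h), is not determined by fixed spaces. It enters the size of the space and, through the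
  orthogonal complement, the size of the radical; in the product of the two it turns into |V|. With
  N = dim V and d(g) the dimension of the fixed space of g, what remains is (- q) to the power d(g)
  + d(h) + d(gh) + N. Normalization divides by (- q) to the power 2 N + 2 d(gh), and d = N - i turns
  the exponent into - i(g) - i(h) + i(gh). Hermitian symmetry belongs to F, not to the F_p-valued f.
  All sums are therefore taken with the character \<theta> (T (\<lambda> x)) of K; that it is
  nontrivial on every line of skew elements comes from \<lambda> \<noteq> \<eta> \<lambda>.\<close>

lemma card_kernel_image:
  fixes \<phi> :: "'a::ab_group_add \<Rightarrow> 'b::ab_group_add"
  assumes "finite W" and diff: "\<And>x y. x \<in> W \<Longrightarrow> y \<in> W \<Longrightarrow> x - y \<in> W"
    and hom: "\<And>x y. x \<in> W \<Longrightarrow> y \<in> W \<Longrightarrow> \<phi> (x - y) = \<phi> x - \<phi> y"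
  shows "card W = card (\<phi> ` W) * card {x \<in> W. \<phi> x = 0}"
proof -
  have fibre: "card {x \<in> W. \<phi> x = \<phi> w} = card {x \<in> W. \<phi> x = 0}" if w: "w \<in> W" for w
  proof -
    have plus: "x + w \<in> W" if "x \<in> W" for x
      using diff[OF that diff[OF diff[OF w w] w]] by simp
    have hom_plus: "\<phi> (x + w) = \<phi> x + \<phi> w" if "x \<in> W" for x
      using hom[OF plus[OF that] w] by simp
    have "bij_betw (\<lambda>x. x - w) {x \<in> W. \<phi> x = \<phi> w} {x \<in> W. \<phi> x = 0}"
      by (rule bij_betwI[where g = "\<lambda>x. x + w"]) (auto simp: diff hom plus hom_plus w)
    then show ?thesis
      by (rule bij_betw_same_card)
  qed
  have "card W = (\<Sum>y\<in>\<phi> ` W. card {x \<in> W. \<phi> x = y})"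
    using sum.image_gen[OF \<open>finite W\<close>, of "\<lambda>_. 1::nat" \<phi>] by simp
  also have "\<dots> = (\<Sum>y\<in>\<phi> ` W. card {x \<in> W. \<phi> x = 0})"
    by (intro sum.cong) (auto simp: fibre)
  finally show ?thesis
    by simp
qed

context vector_space
begin

lemma finite_span:
  assumes "finite B" and "finite (UNIV :: 'a set)"
  shows "finite (span B)"
proof (rule finite_subset)
  show "span B \<subseteq> (\<lambda>c. \<Sum>b\<in>B. scale (c b) b) ` (B \<rightarrow>\<^sub>E UNIV)"
  proof
    fix w assume "w \<in> span B"
    then obtain c where "w = (\<Sum>b\<in>B. scale (c b) b)"
      using span_finite[OF assms(1)] by auto
    then have "w = (\<Sum>b\<in>B. scale (restrict c B b) b)"
      by simp
    then show "w \<in> (\<lambda>c. \<Sum>b\<in>B. scale (c b) b) ` (B \<rightarrow>\<^sub>E UNIV)"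
      by (rule image_eqI[where x = "restrict c B"]) auto
  qed
qed (simp add: assms finite_PiE)

lemma card_subspace:
  assumes W: "subspace W" and fin: "finite W"
  shows "card W = CARD('a) ^ dim W"
proof -
  obtain B where B: "B \<subseteq> W" "independent B" "W \<subseteq> span B" "card B = dim W"
    by (rule basis_exists)
  have finB: "finite B"
    by (rule finite_subset[OF B(1) fin])
  have spanB: "span B = W"
    using B W by (simp add: span_minimal subset_antisym)
  have "bij_betw (\<lambda>c. \<Sum>b\<in>B. scale (c b) b) (B \<rightarrow>\<^sub>E UNIV) W"
  proof (rule bij_betw_imageI)
    show "inj_on (\<lambda>c. \<Sum>b\<in>B. scale (c b) b) (B \<rightarrow>\<^sub>E UNIV)"
    proof (rule inj_onI)
      fix c d :: "'b \<Rightarrow> 'a"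
      assume c: "c \<in> B \<rightarrow>\<^sub>E UNIV" and d: "d \<in> B \<rightarrow>\<^sub>E UNIV"
        and "(\<Sum>b\<in>B. scale (c b) b) = (\<Sum>b\<in>B. scale (d b) b)"
      then have "(\<Sum>b\<in>B. scale (c b - d b) b) = 0"
        by (simp add: scale_left_diff_distrib sum_subtractf)
      then have "c b = d b" if "b \<in> B" for b
        using independentD[OF B(2) finB subset_refl, of "\<lambda>b. c b - d b"] that by simp
      then show "c = d"
        using c d by (auto intro: PiE_ext)
    qed
    show "(\<lambda>c. \<Sum>b\<in>B. scale (c b) b) ` (B \<rightarrow>\<^sub>E UNIV) = W"
    proof
      show "(\<lambda>c. \<Sum>b\<in>B. scale (c b) b) ` (B \<rightarrow>\<^sub>E UNIV) \<subseteq> W"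
        using B(1) W by (auto intro!: subspace_sum subspace_scale)
      show "W \<subseteq> (\<lambda>c. \<Sum>b\<in>B. scale (c b) b) ` (B \<rightarrow>\<^sub>E UNIV)"
      proof
        fix w assume "w \<in> W"
        then obtain c where "w = (\<Sum>b\<in>B. scale (c b) b)"
          using spanB span_finite[OF finB] by auto
        then have "w = (\<Sum>b\<in>B. scale (restrict c B b) b)"
          by simp
        then show "w \<in> (\<lambda>c. \<Sum>b\<in>B. scale (c b) b) ` (B \<rightarrow>\<^sub>E UNIV)"
          by (rule image_eqI[where x = "restrict c B"]) auto
      qed
    qed
  qed
  then have "card W = card (B \<rightarrow>\<^sub>E (UNIV :: 'a set))"
    by (simp add: bij_betw_same_card)
  then show ?thesis
    using B(4) finB by (simp add: card_PiE)
qed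

end

text \<open>Both sides of the identity count the pairs \<open>(x, v)\<close> with \<open>x \<in> M\<close> and \<open>F x v = 0\<close>: for fixed
  \<open>v\<close> or \<open>x\<close> the solutions form a hyperplane, unless the linear form vanishes.\<close>

lemma card_annihilator:
  fixes scale :: "'k::{field,finite} \<Rightarrow> 'v::ab_group_add \<Rightarrow> 'v"
  assumes V: "vector_space scale" "finite (UNIV :: 'v set)"
    and add: "\<And>x x' y. F (x - x') y = F x y - (F x' y :: 'k)"
    and add': "\<And>x y y'. F x (y - y') = F x y - F x y'"
    and scale: "\<And>c x y. F (scale c x) y = c * F x y"
    and scale': "\<And>c x y. F x (scale c y) = \<eta> c * F x y"
    and \<eta>: "surj \<eta>"
    and nondeg: "\<And>x. (\<And>y. F x y = 0) \<Longrightarrow> x = 0"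
    and M: "module.subspace scale M"
  shows "card M * card {y. \<forall>x\<in>M. F x y = 0} = CARD('v)"
proof -
  interpret vector_space scale by (rule V(1))
  define Q where "Q = CARD('k)"
  have fin [simp]: "finite A" for A :: "'v set"
    by (rule finite_subset[OF subset_UNIV V(2)])
  have Q: "Q > 1"
  proof -
    have "card {0, 1::'k} \<le> Q"
      unfolding Q_def by (rule card_mono) auto
    then show ?thesis by simp
  qed
  define P where "P = {y. \<forall>x\<in>M. F x y = 0}"
  have surj: "(\<lambda>x. F x y) ` M = UNIV" if "y \<notin> P" for y
  proof -
    obtain x where x: "x \<in> M" "F x y \<noteq> 0"
      using \<open>y \<notin> P\<close> by (auto simp: P_def)
    have "c = F (scale (c / F x y) x) y" for c
      using x by (simp add: scale)
    then show ?thesis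
      using x(1) M by (auto intro!: image_eqI subspace_scale)
  qed
  have surj': "range (F x) = UNIV" if "x \<noteq> 0" for x
  proof -
    obtain y where y: "F x y \<noteq> 0"
      using nondeg \<open>x \<noteq> 0\<close> by blast
    have "c \<in> range (F x)" for c
    proof -
      obtain d where "\<eta> d = c / F x y"
        using \<eta> by (metis surjD)
      then have "F x (scale d y) = c"
        using y by (simp add: scale')
      then show ?thesis by blast
    qed
    then show ?thesis by auto
  qed
  have zero: "F 0 y = 0" for y
    using add[of 0 0] by simp
  have left: "Q * card {x \<in> M. F x y = 0} = (if y \<in> P then Q * card M else card M)" for y
  proof (cases "y \<in> P")
    case True
    then have "{x \<in> M. F x y = 0} = M"
      by (auto simp: P_def)
    with True show ?thesis by simp
  next
    case False
    have "card M = card ((\<lambda>x. F x y) ` M) * card {x \<in> M. F x y = 0}"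
      by (rule card_kernel_image) (auto simp: add intro: subspace_diff M)
    with False show ?thesis
      by (simp add: surj Q_def)
  qed
  have right: "Q * card {y. F x y = 0} = (if x = 0 then Q * CARD('v) else CARD('v))" for x
  proof (cases "x = 0")
    case False
    have "CARD('v) = card (range (F x)) * card {y \<in> UNIV. F x y = 0}"
      by (rule card_kernel_image) (auto simp: add')
    with False show ?thesis
      by (simp add: surj' Q_def)
  qed (simp add: zero)
  have "(\<Sum>y\<in>UNIV. Q * card {x \<in> M. F x y = 0}) = (\<Sum>x\<in>M. Q * card {y. F x y = 0})"
  proof -
    have "(\<Sum>y\<in>UNIV. card {x \<in> M. F x y = 0}) = (\<Sum>x\<in>M. card {y. F x y = 0})"
      using sum.swap_restrict[of UNIV M "\<lambda>_ _. 1::nat" "\<lambda>y x. F x y = 0"] by simp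
    then show ?thesis
      by (simp flip: sum_distrib_left)
  qed
  moreover have "(\<Sum>y\<in>UNIV. if y \<in> P then Q * card M else card M)
      = card P * (Q * card M) + card (- P) * card M"
    by (subst sum.If_cases) (auto simp: Compl_eq)
  moreover have "(\<Sum>x\<in>M. if x = 0 then Q * CARD('v) else CARD('v))
      = Q * CARD('v) + (card M - 1) * CARD('v)"
    using M by (subst sum.remove[of _ 0]) (auto simp: subspace_0)
  moreover have "card (- P) + card P = CARD('v)"
    using card_Un_disjoint[of "- P" P] by (simp add: Un_commute)
  moreover have "card M > 0"
    using M subspace_0 by (auto simp: card_gt_0_iff)
  ultimately have *: "card P * (Q * card M) + card (- P) * card M
      = Q * CARD('v) + (card M - 1) * CARD('v)" and "card (- P) + card P = CARD('v)"
    unfolding left right by simp_all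
  \<comment> \<open>Over the integers the truncated subtractions disappear; after rearranging, both
    sides carry the positive factor \<open>Q - 1\<close>.\<close>
  moreover have "int (card (- P)) = int CARD('v) - int (card P)"
    using \<open>card (- P) + card P = CARD('v)\<close> by linarith
  moreover have "int (card M - 1) = int (card M) - 1"
    using \<open>card M > 0\<close> by (simp add: of_nat_diff)
  ultimately have "int (card P) * (int Q * int (card M)) + (int CARD('v) - int (card P)) * int (card M)
      = int Q * int CARD('v) + (int (card M) - 1) * int CARD('v)"
    by (metis of_nat_add of_nat_mult)
  then have "(int Q - 1) * (int (card M) * int (card P)) = (int Q - 1) * int CARD('v)"
    by (simp add: algebra_simps)
  then have "int (card M * card P) = int CARD('v)"
    using Q by simp
  then show ?thesis
    unfolding P_def by linarith
qed

subsection \<open>The absolute trace\<close>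

text \<open>The integer representative in the definition of the embedding does not respect addition
  or multiplication. Every element of \<open>'p mod_ring\<close> is the image of a natural number,
  though, and on these the homomorphism laws are immediate.\<close>

lemma prime_field_emb_of_nat:
  assumes "CHAR('k::field) = CARD('p::prime_card)"
  shows "prime_field_emb (of_nat n :: 'p mod_ring) = (of_nat n :: 'k)"
proof -
  have "to_int_mod_ring (of_nat n :: 'p mod_ring) = int n mod int CARD('p)"
    by (simp add: of_nat_of_int_mod_ring, transfer, simp)
  then show ?thesis
    using of_int_mod_CHAR[where ?'a = 'k, of "int n"] by (simp add: prime_field_emb_def assms)
qed

lemma prime_field_emb_hom:
  assumes "CHAR('k::field) = CARD('p::prime_card)"
  shows "prime_field_emb (a + b :: 'p mod_ring) = (prime_field_emb a + prime_field_emb b :: 'k)"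
    and "prime_field_emb (a * b :: 'p mod_ring) = (prime_field_emb a * prime_field_emb b :: 'k)"
    and "prime_field_emb (1 :: 'p mod_ring) = (1 :: 'k)"
    and "prime_field_emb (0 :: 'p mod_ring) = (0 :: 'k)"
proof -
  obtain m n where mn: "a = of_nat m" "b = of_nat n"
    using surj_of_nat_mod_ring by blast
  show "prime_field_emb (a + b) = (prime_field_emb a + prime_field_emb b :: 'k)"
    unfolding mn prime_field_emb_of_nat[OF assms] of_nat_add[symmetric] ..
  show "prime_field_emb (a * b) = (prime_field_emb a * prime_field_emb b :: 'k)"
    unfolding mn prime_field_emb_of_nat[OF assms] of_nat_mult[symmetric] ..
  show "prime_field_emb (1 :: 'p mod_ring) = (1 :: 'k)" "prime_field_emb (0 :: 'p mod_ring) = (0 :: 'k)"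
    using prime_field_emb_of_nat[OF assms, of 1] prime_field_emb_of_nat[OF assms, of 0] by simp_all
qed

lemma vector_space_prime_field:
  fixes scale :: "'k::field \<Rightarrow> 'v::ab_group_add \<Rightarrow> 'v"
  assumes "CHAR('k) = CARD('p::prime_card)" and "vector_space scale"
  shows "vector_space (\<lambda>a::'p mod_ring. scale (prime_field_emb a))"
proof -
  interpret vector_space scale by fact
  show ?thesis
    by unfold_locales
      (simp_all add: prime_field_emb_hom[OF assms(1)] scale_right_distrib scale_left_distrib)
qed

lemma inj_prime_field_emb:
  assumes "CHAR('k::field) = CARD('p::prime_card)"
  shows "inj (prime_field_emb :: 'p mod_ring \<Rightarrow> 'k)"
proof (rule injI)
  fix a b :: "'p mod_ring"
  assume eq: "(prime_field_emb a :: 'k) = prime_field_emb b"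
  obtain m n where mn: "m < CARD('p)" "a = of_nat m" "n < CARD('p)" "b = of_nat n"
    using surj_of_nat_mod_ring by blast
  have "(of_nat m :: 'k) = of_nat n"
    using eq unfolding mn prime_field_emb_of_nat[OF assms] .
  then have "[m = n] (mod CARD('p))"
    using of_nat_eq_iff_cong_CHAR[where ?'a = 'k] assms by metis
  with mn show "a = b"
    by (simp add: cong_def)
qed

context
  fixes ty_k :: "'k::{field,finite} itself" and ty_p :: "'p::prime_card itself"
  assumes char: "CHAR('k) = CARD('p)"
begin

lemma prime_char: "prime CHAR('k)"
  using char prime_card[where ?'a = 'p] by simp

lemma power_card_field: "x ^ CARD('k) = (x :: 'k)"
proof (cases "x = 0")
  case False
  have "bij_betw ((*) x) (- {0}) (- {0})"
    using False by (intro bij_betwI[where g = "\<lambda>y. y / x"]) auto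
  then have "(\<Prod>y\<in>- {0}. x * y) = \<Prod>(- {0})"
    using prod.reindex_bij_betw[of "(*) x" _ _ "\<lambda>y. y"] by simp
  then have "x ^ card (- {0 :: 'k}) = 1"
    by (simp add: prod.distrib)
  then have "x ^ (CARD('k) - 1) = 1"
    by (simp add: Compl_eq_Diff_UNIV)
  then show ?thesis
    using power_Suc[of x "CARD('k) - 1"]
    by (simp only: Suc_diff_1[OF zero_less_card_finite] mult_1_right)
qed auto

text \<open>Fermat's little theorem puts the p elements of the prime field among the roots of X^p -
  X, which has at most p. Being fixed by Frobenius is the test by which a sum of conjugates is
  recognized as an element of the prime field.\<close>

lemma range_prime_field_emb:
  "range (prime_field_emb :: 'p mod_ring \<Rightarrow> 'k) = {x. x ^ CARD('p) = x}"
proof (rule card_subset_eq)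
  let ?g = "monom 1 CARD('p) + monom (- 1) 1 :: 'k poly"
  have p: "CARD('p) > 1"
    using prime_card[where ?'a = 'p] prime_gt_1_nat by blast
  have "degree ?g = CARD('p)"
    using p by (subst degree_add_eq_left) (auto simp: degree_monom_eq)
  then have g: "?g \<noteq> 0"
    using p by auto
  have roots: "{x. x ^ CARD('p) = x} = {x. poly ?g x = (0 :: 'k)}"
    by (auto simp: poly_monom)
  then have le: "card {x::'k. x ^ CARD('p) = x} \<le> CARD('p)"
    using card_poly_roots_bound[OF g] \<open>degree ?g = CARD('p)\<close> by simp
  show "range (prime_field_emb :: 'p mod_ring \<Rightarrow> 'k) \<subseteq> {x. x ^ CARD('p) = x}"
  proof safe
    fix a :: "'p mod_ring"
    obtain n where n: "a = of_nat n"
      using surj_of_nat_mod_ring by blast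
    have "[n ^ CARD('p) = n] (mod CARD('p))"
    proof (cases "CARD('p) dvd n")
      case True
      then have "CARD('p) dvd n ^ CARD('p)"
        using p dvd_power_le by (metis dvd_power dvd_trans less_imp_triv not_gr_zero zero_less_card_finite)
      with True show ?thesis
        by (simp add: cong_def dvd_imp_mod_0)
    next
      case False
      then have "[n ^ (CARD('p) - 1) = 1] (mod CARD('p))"
        by (rule fermat_theorem[OF prime_card])
      then have "[n ^ (CARD('p) - 1) * n = 1 * n] (mod CARD('p))"
        by (rule cong_mult[OF _ cong_refl])
      moreover have "n ^ (CARD('p) - 1) * n = n ^ CARD('p)"
        using p by (metis less_imp_Suc_add One_nat_def diff_Suc_1 power_Suc2 add_Suc_right)
      ultimately show ?thesis by simp
    qed
    then have "(of_nat (n ^ CARD('p)) :: 'k) = of_nat n"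
      using of_nat_eq_iff_cong_CHAR[where ?'a = 'k] char by metis
    then show "(prime_field_emb a :: 'k) ^ CARD('p) = prime_field_emb a"
      unfolding n prime_field_emb_of_nat[OF char] by simp
  qed
  have "card (range (prime_field_emb :: 'p mod_ring \<Rightarrow> 'k)) = CARD('p)"
    using card_image[OF inj_prime_field_emb[OF char]] by simp
  then show "card (range (prime_field_emb :: 'p mod_ring \<Rightarrow> 'k)) = card {x::'k. x ^ CARD('p) = x}"
    using le card_mono[OF _ \<open>range prime_field_emb \<subseteq> _\<close>] by simp
qed simp

text \<open>This discharges the definite description in \<open>abs_trace\<close>: since x^|K| = x,
  Frobenius permutes the summands cyclically, so their sum lies in the prime field.\<close>

lemma prime_field_emb_abs_trace:
  "prime_field_emb (abs_trace (x::'k) :: 'p mod_ring) =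
     (\<Sum>i<vector_space.dim (\<lambda>(a::'p mod_ring) (y::'k). prime_field_emb a * y) UNIV. x ^ (CARD('p) ^ i))"
proof -
  interpret K: vector_space "\<lambda>(a::'p mod_ring) (y::'k). prime_field_emb a * y"
    by unfold_locales (simp_all add: prime_field_emb_hom[OF char] algebra_simps)
  let ?s = "\<lambda>x::'k. \<Sum>i<K.dim UNIV. x ^ (CARD('p) ^ i)"
  have card: "CARD('k) = CARD('p) ^ K.dim UNIV"
    using K.card_subspace[OF K.subspace_UNIV] by simp
  have "?s x ^ CARD('p) = (\<Sum>i<K.dim UNIV. x ^ (CARD('p) ^ Suc i))"
    using freshmans_dream_sum[OF prime_char, of "CARD('p)" "\<lambda>i. x ^ (CARD('p) ^ i)" "{..<K.dim UNIV}"]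
    by (simp add: char mult.commute flip: power_mult)
  also have "\<dots> = ?s x"
    using sum.lessThan_Suc_shift[of "\<lambda>i. x ^ (CARD('p) ^ i)" "K.dim UNIV"]
      sum.lessThan_Suc[of "\<lambda>i. x ^ (CARD('p) ^ i)" "K.dim UNIV"] power_card_field[of x]
    by (simp add: card)
  finally have "?s x \<in> range (prime_field_emb :: 'p mod_ring \<Rightarrow> 'k)"
    unfolding range_prime_field_emb by simp
  then obtain t where t: "prime_field_emb (t :: 'p mod_ring) = ?s x"
    by (metis rangeE)
  then have "abs_trace x = t"
    unfolding abs_trace_def
    by (rule the_equality) (simp_all only: t[symmetric] inj_eq[OF inj_prime_field_emb[OF char]])
  with t show ?thesis by simp
qed

lemma card_prime_power: "\<exists>d. CARD('k) = CARD('p) ^ d"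
proof -
  interpret K: vector_space "\<lambda>(a::'p mod_ring) (y::'k). prime_field_emb a * y"
    by unfold_locales (simp_all add: prime_field_emb_hom[OF char] algebra_simps)
  show ?thesis
    using K.card_subspace[OF K.subspace_UNIV] by auto
qed

lemma abs_trace_add: "abs_trace (x + y) = (abs_trace (x::'k) + abs_trace y :: 'p mod_ring)"
proof -
  have "(x + y) ^ (CARD('p) ^ i) = x ^ (CARD('p) ^ i) + y ^ (CARD('p) ^ i)" for i
    using freshmans_dream'[OF prime_char, of "CARD('p) ^ i" i x y] by (simp add: char)
  then show ?thesis
    by (intro injD[OF inj_prime_field_emb[OF char]])
      (simp add: prime_field_emb_abs_trace prime_field_emb_hom[OF char] sum.distrib)
qed

text \<open>\<open>\<eta>\<close> commutes with sums and powers and fixes the prime field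
  pointwise.\<close>

lemma abs_trace_automorphism:
  assumes "field_automorphism \<eta>"
  shows "abs_trace (\<eta> (x::'k)) = (abs_trace x :: 'p mod_ring)"
proof -
  have add: "\<eta> (x + y) = \<eta> x + \<eta> y" and mult: "\<eta> (x * y) = \<eta> x * \<eta> y" and "\<eta> 1 = 1" for x y
    using assms by (auto simp: field_automorphism_def)
  have "\<eta> 0 = 0"
    using add[of 0 0] by (metis add.right_neutral add_cancel_right_right)
  have power: "\<eta> (x ^ n) = \<eta> x ^ n" for x n
    by (induction n) (simp_all add: mult \<open>\<eta> 1 = 1\<close>)
  have sum: "\<eta> (sum g A) = (\<Sum>a\<in>A. \<eta> (g a))" for g and A :: "nat set"
    by (induction A rule: infinite_finite_induct) (simp_all add: add \<open>\<eta> 0 = 0\<close>)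
  have nat: "\<eta> (of_nat n) = of_nat n" for n
    by (induction n) (simp_all add: add \<open>\<eta> 0 = 0\<close> \<open>\<eta> 1 = 1\<close>)
  have emb: "\<eta> (prime_field_emb t) = prime_field_emb t" for t :: "'p mod_ring"
  proof -
    obtain n where n: "t = of_nat n"
      using surj_of_nat_mod_ring by blast
    show ?thesis
      unfolding n prime_field_emb_of_nat[OF char] by (rule nat)
  qed
  have "(prime_field_emb (abs_trace (\<eta> x) :: 'p mod_ring) :: 'k) = \<eta> (prime_field_emb (abs_trace x :: 'p mod_ring))"
    unfolding prime_field_emb_abs_trace by (simp add: sum power)
  also have "\<dots> = prime_field_emb (abs_trace x :: 'p mod_ring)"
    by (rule emb)
  finally show ?thesis
    by (rule injD[OF inj_prime_field_emb[OF char]])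
qed

text \<open>The trace is given by a polynomial of degree below |K|, so it cannot vanish on all of K;
  its coefficient at X is 1, so it is not the zero polynomial.\<close>

lemma abs_trace_nonzero: "\<exists>x::'k. abs_trace x \<noteq> (0 :: 'p mod_ring)"
proof (rule ccontr)
  interpret K: vector_space "\<lambda>(a::'p mod_ring) (y::'k). prime_field_emb a * y"
    by unfold_locales (simp_all add: prime_field_emb_hom[OF char] algebra_simps)
  let ?g = "\<Sum>i<K.dim UNIV. monom (1::'k) (CARD('p) ^ i)"
  assume "\<not> ?thesis"
  then have root: "poly ?g x = 0" for x
    using prime_field_emb_abs_trace[of x] by (simp add: poly_sum poly_monom prime_field_emb_hom(4)[OF char])
  have p: "CARD('p) > 1"
    using prime_card[where ?'a = 'p] prime_gt_1_nat by blast
  have card: "CARD('k) = CARD('p) ^ K.dim UNIV"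
    using K.card_subspace[OF K.subspace_UNIV] by simp
  have "K.dim UNIV \<noteq> 0"
  proof
    assume "K.dim UNIV = 0"
    then have "CARD('k) = 1" using card by simp
    then show False
      using card_mono[of "UNIV :: 'k set" "{0, 1}"] by simp
  qed
  then have "coeff ?g 1 = (\<Sum>i\<in>{0::nat}. 1)"
    unfolding coeff_sum coeff_monom using p
    by (intro sum.mono_neutral_cong_right) (auto simp: power_eq_1_iff)
  then have "?g \<noteq> 0"
    by auto
  then have "card {x. poly ?g x = 0} \<le> degree ?g"
    by (rule card_poly_roots_bound)
  also have "\<dots> \<le> CARD('p) ^ (K.dim UNIV - 1)"
  proof (intro degree_sum_le)
    fix i assume "i \<in> {..<K.dim UNIV}"
    then have "CARD('p) ^ i \<le> CARD('p) ^ (K.dim UNIV - 1)"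
      using p by (intro power_increasing) auto
    then show "degree (monom (1::'k) (CARD('p) ^ i)) \<le> CARD('p) ^ (K.dim UNIV - 1)"
      by (rule order_trans[OF degree_monom_le])
  qed simp
  also have "\<dots> < CARD('p) ^ K.dim UNIV"
    using p \<open>K.dim UNIV \<noteq> 0\<close> by (intro power_strict_increasing) auto
  finally show False
    using root card by simp
qed

end

subsection \<open>Gauss sums of skew-Hermitian forms\<close>

text \<open>Multiplicative counterpart of \<open>card_kernel_image\<close>, meant for the norm and
  for \<open>x / \<eta> x\<close> on the units of K. The size of a single fibre is kept as a
  separate claim because the sum over norms needs it.\<close>

lemma card_kernel_image_units:
  fixes \<phi> :: "'k::{field,finite} \<Rightarrow> 'k"
  assumes div: "\<And>x y. \<phi> (x / y) = \<phi> x / \<phi> y" and nz: "\<And>x. x \<noteq> 0 \<Longrightarrow> \<phi> x \<noteq> 0"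
  shows "w \<noteq> 0 \<Longrightarrow> card {x. x \<noteq> 0 \<and> \<phi> x = \<phi> w} = card {x. x \<noteq> 0 \<and> \<phi> x = 1}"
    and "CARD('k) - 1 = card (\<phi> ` (UNIV - {0})) * card {x. x \<noteq> 0 \<and> \<phi> x = 1}"
proof -
  have fibre: "card {x. x \<noteq> 0 \<and> \<phi> x = \<phi> w} = card {x. x \<noteq> 0 \<and> \<phi> x = 1}" if w: "w \<noteq> 0" for w
  proof -
    have "\<phi> 1 = 1"
      using div[of 1 1] nz[of 1] by simp
    then have mult: "\<phi> (x * w) = \<phi> x * \<phi> w" for x
      using div[of x "1 / w"] div[of 1 w] by simp
    have "bij_betw (\<lambda>x. x / w) {x. x \<noteq> 0 \<and> \<phi> x = \<phi> w} {x. x \<noteq> 0 \<and> \<phi> x = 1}"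
      by (rule bij_betwI[where g = "\<lambda>x. x * w"]) (auto simp: div mult w nz)
    then show ?thesis
      by (rule bij_betw_same_card)
  qed
  show "w \<noteq> 0 \<Longrightarrow> card {x. x \<noteq> 0 \<and> \<phi> x = \<phi> w} = card {x. x \<noteq> 0 \<and> \<phi> x = 1}"
    by (rule fibre)
  have "card (UNIV - {0::'k}) = (\<Sum>y\<in>\<phi> ` (UNIV - {0}). card {x \<in> UNIV - {0}. \<phi> x = y})"
    using sum.image_gen[of "UNIV - {0::'k}" "\<lambda>_. 1::nat" \<phi>] by simp
  also have "\<dots> = (\<Sum>y\<in>\<phi> ` (UNIV - {0}). card {x. x \<noteq> 0 \<and> \<phi> x = 1})"
  proof (rule sum.cong)
    fix y assume "y \<in> \<phi> ` (UNIV - {0})"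
    then obtain w where "w \<noteq> 0" "y = \<phi> w" by auto
    then show "card {x \<in> UNIV - {0}. \<phi> x = y} = card {x. x \<noteq> 0 \<and> \<phi> x = 1}"
      using fibre[of w] by simp
  qed simp
  finally show "CARD('k) - 1 = card (\<phi> ` (UNIV - {0})) * card {x. x \<noteq> 0 \<and> \<phi> x = 1}"
    by (simp add: card_Diff_subset)
qed

lemma square_diff_one_nat: "n ^ 2 - 1 = (n - 1) * (n + 1)" for n :: nat
  by (cases n) (simp_all add: power2_eq_square)

section \<open>Finite fields with an involution, and their norm map\<close>

locale field_involution =
  fixes \<eta> :: "'k::{field,finite} \<Rightarrow> 'k"
  assumes automorphism: "field_automorphism \<eta>"
    and involution [simp]: "\<eta> (\<eta> x) = x"
    and nontrivial: "\<eta> \<noteq> id"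
begin

abbreviation q :: nat where "q \<equiv> card {x. \<eta> x = x}"

lemma \<eta>_add [simp]: "\<eta> (x + y) = \<eta> x + \<eta> y"
  and \<eta>_mult [simp]: "\<eta> (x * y) = \<eta> x * \<eta> y"
  and \<eta>_1 [simp]: "\<eta> 1 = 1"
  using automorphism by (auto simp: field_automorphism_def)

lemma \<eta>_0 [simp]: "\<eta> 0 = 0"
  using \<eta>_add[of 0 0] by (metis add.right_neutral add_cancel_right_right)

lemma \<eta>_minus [simp]: "\<eta> (- x) = - \<eta> x"
  using \<eta>_add[of x "- x"] by (simp add: eq_neg_iff_add_eq_0 add.commute del: \<eta>_add)

lemma \<eta>_diff [simp]: "\<eta> (x - y) = \<eta> x - \<eta> y"
  using \<eta>_add[of x "- y"] by simp

lemma \<eta>_eq_0_iff [simp]: "\<eta> x = 0 \<longleftrightarrow> x = 0"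
  by (metis \<eta>_0 involution)

lemma \<eta>_divide [simp]: "\<eta> (x / y) = \<eta> x / \<eta> y"
proof (cases "y = 0")
  case False
  have "\<eta> (x / y) * \<eta> y = \<eta> x"
    using \<eta>_mult[of "x / y" y] False by (simp del: \<eta>_mult)
  then show ?thesis
    using False by (simp add: eq_divide_eq)
qed simp

lemma nontrivial_ex: "\<exists>x. \<eta> x \<noteq> x"
  using nontrivial by auto

lemma surj_\<eta>: "surj \<eta>"
  by (rule surjI[of \<eta> \<eta>]) simp

lemma card_field: "CARD('k) = q ^ 2"
proof -
  obtain \<theta> where \<theta>: "\<eta> \<theta> \<noteq> \<theta>"
    using nontrivial_ex by blast
  \<comment> \<open>The coordinate of \<open>x\<close> at \<open>\<theta>\<close> in the basis 1,
    \<open>\<theta>\<close> over the fixed field: subtracting from x = a + b \<theta> its conjugate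
    eliminates a.\<close>
  define b where "b x = (x - \<eta> x) / (\<theta> - \<eta> \<theta>)" for x
  have b: "\<eta> (b x) = b x" for x
    using minus_divide_divide[of "x - \<eta> x" "\<theta> - \<eta> \<theta>"] by (simp add: b_def)
  have b': "b x * (\<theta> - \<eta> \<theta>) = x - \<eta> x" for x
    using \<theta> by (simp add: b_def)
  have "bij_betw (\<lambda>x. (x - b x * \<theta>, b x)) UNIV ({x. \<eta> x = x} \<times> {x. \<eta> x = x})"
  proof (rule bij_betwI[where g = "\<lambda>(a, b). a + b * \<theta>"])
    have "\<eta> x - b x * \<eta> \<theta> = x - b x * \<theta>" for x
      using b'[of x] by (simp add: algebra_simps)
    then show "(\<lambda>x. (x - b x * \<theta>, b x)) \<in> UNIV \<rightarrow> {x. \<eta> x = x} \<times> {x. \<eta> x = x}"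
      by (auto simp: b)
    fix y assume "y \<in> {x. \<eta> x = x} \<times> {x. \<eta> x = x}"
    then obtain c d where y: "y = (c, d)" "\<eta> c = c" "\<eta> d = d"
      by auto
    have "b (c + d * \<theta>) = d"
      using \<theta> y by (simp add: b_def divide_eq_eq algebra_simps)
    then show "(case (case y of (a, b) \<Rightarrow> a + b * \<theta>) of x \<Rightarrow> (x - b x * \<theta>, b x)) = y"
      by (simp add: y)
  qed auto
  then have "CARD('k) = card ({x. \<eta> x = x} \<times> {x. \<eta> x = x})"
    by (rule bij_betw_same_card)
  then show ?thesis
    by (simp add: card_cartesian_product power2_eq_square)
qed

lemma q_gt_1: "q > 1"
proof -
  have "card {0, 1::'k} \<le> q"
    by (rule card_mono) auto
  then show ?thesis by simp
qed

text \<open>The kernel of the norm is computed by Hilbert 90: it is the image of \<open>x \<mapsto> x / \<eta> x\<close>.\<close>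

lemma card_norm_one: "card {x. x \<noteq> 0 \<and> x * \<eta> x = 1} = q + 1"
proof -
  have "{x. x \<noteq> 0 \<and> x * \<eta> x = 1} = (\<lambda>y. y / \<eta> y) ` (UNIV - {0})"
  proof (intro subset_antisym subsetI)
    fix x assume "x \<in> {x. x \<noteq> 0 \<and> x * \<eta> x = 1}"
    then have x: "x \<noteq> 0" "x * \<eta> x = 1" by auto
    \<comment> \<open>The resolvent of Hilbert 90. The choice \<open>z = 1\<close> fails only for
      \<open>x = - 1\<close>, and there any element moved by \<open>\<eta>\<close> will do.\<close>
    obtain z where z: "z + x * \<eta> z \<noteq> 0"
    proof (cases "x = - 1")
      case True
      then show ?thesis
        using nontrivial_ex that by fastforce
    next
      case False
      then have "1 + x * \<eta> 1 \<noteq> 0"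
        by (simp add: add_eq_0_iff)
      then show ?thesis by (rule that)
    qed
    have "x * \<eta> (z + x * \<eta> z) = z + x * \<eta> z"
      using x(2) by (simp add: algebra_simps)
    then have "x = (z + x * \<eta> z) / \<eta> (z + x * \<eta> z)"
      using z by (metis \<eta>_eq_0_iff nonzero_mult_div_cancel_right)
    then show "x \<in> (\<lambda>y. y / \<eta> y) ` (UNIV - {0})"
      using z by blast
  qed auto
  moreover have "CARD('k) - 1 = card ((\<lambda>y. y / \<eta> y) ` (UNIV - {0})) * card {x. x \<noteq> 0 \<and> x / \<eta> x = 1}"
    by (rule card_kernel_image_units) auto
  moreover have "{x. x \<noteq> 0 \<and> x / \<eta> x = 1} = {x. \<eta> x = x} - {0}"
    by auto
  then have "card {x. x \<noteq> 0 \<and> x / \<eta> x = 1} = q - 1"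
    by (simp add: card_Diff_subset)
  ultimately have "q ^ 2 - 1 = card {x. x \<noteq> 0 \<and> x * \<eta> x = 1} * (q - 1)"
    by (simp only: card_field)
  then have "(q + 1) * (q - 1) = card {x. x \<noteq> 0 \<and> x * \<eta> x = 1} * (q - 1)"
    unfolding mult.commute[of "q + 1" "q - 1"] square_diff_one_nat[symmetric] .
  then show ?thesis
    using q_gt_1 by (simp only: mult_cancel2) simp
qed

text \<open>The norm has kernel of order q + 1, so its image has (q^2 - 1) / (q + 1) = q - 1
  elements, as many as the units of the fixed field.\<close>

lemma norm_image: "(\<lambda>x. x * \<eta> x) ` (UNIV - {0}) = {t. \<eta> t = t} - {0}"
proof (rule card_subset_eq)
  have "CARD('k) - 1 = card ((\<lambda>x. x * \<eta> x) ` (UNIV - {0})) * card {x. x \<noteq> 0 \<and> x * \<eta> x = 1}"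
    by (rule card_kernel_image_units) auto
  then have "(q - 1) * (q + 1) = card ((\<lambda>x. x * \<eta> x) ` (UNIV - {0})) * (q + 1)"
    unfolding card_norm_one card_field square_diff_one_nat by simp
  then have "card ((\<lambda>x. x * \<eta> x) ` (UNIV - {0})) = q - 1"
    by (simp only: mult_cancel2) simp
  then show "card ((\<lambda>x. x * \<eta> x) ` (UNIV - {0})) = card ({t. \<eta> t = t} - {0})"
    by (simp add: card_Diff_subset)
qed (auto simp: mult.commute)

end

text \<open>The diagonal values of a skew-Hermitian form are skew elements, and the skew elements
  form a line over the fixed field. \<open>\<chi>_skew\<close> asks that \<open>\<chi>\<close> be
  nontrivial on this line, which is what makes the sums over it vanish.\<close>

locale involution_character = field_involution \<eta> for \<eta> :: "'k::{field,finite} \<Rightarrow> 'k" +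
  fixes \<chi> :: "'k \<Rightarrow> 'l::field"
  assumes \<chi>_add: "\<chi> (x + y) = \<chi> x * \<chi> y"
    and \<chi>_0 [simp]: "\<chi> 0 = 1"
    and \<chi>_skew: "c \<noteq> 0 \<Longrightarrow> \<eta> c = - c \<Longrightarrow> \<exists>t. \<eta> t = t \<and> \<chi> (c * t) \<noteq> 1"
begin

lemma sum_fixed_field:
  assumes "c \<noteq> 0" "\<eta> c = - c"
  shows "(\<Sum>t | \<eta> t = t. \<chi> (c * t)) = 0"
proof -
  obtain s where s: "\<eta> s = s" "\<chi> (c * s) \<noteq> 1"
    using \<chi>_skew[OF assms] by blast
  have "(\<Sum>t | \<eta> t = t. \<chi> (c * t)) = (\<Sum>t | \<eta> t = t. \<chi> (c * (s + t)))"
    by (rule sum.reindex_bij_witness[of _ "\<lambda>t. s + t" "\<lambda>t. t - s"]) (auto simp: s)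
  also have "\<dots> = \<chi> (c * s) * (\<Sum>t | \<eta> t = t. \<chi> (c * t))"
    by (simp add: distrib_left \<chi>_add sum_distrib_left)
  finally show ?thesis
    using s(2) by (metis mult_cancel_right1)
qed

text \<open>The origin of the base - q: \<open>x = 0\<close> contributes 1, and each nonzero t in
  the fixed field is hit q + 1 times, where the values \<open>\<chi> (c * t)\<close> add up to -
  1.\<close>

lemma sum_norm:
  assumes "c \<noteq> 0" "\<eta> c = - c"
  shows "(\<Sum>x\<in>UNIV. \<chi> (c * (x * \<eta> x))) = - of_nat q"
proof -
  have "(\<Sum>x\<in>UNIV - {0}. \<chi> (c * (x * \<eta> x)))
      = (\<Sum>t\<in>(\<lambda>x. x * \<eta> x) ` (UNIV - {0}). \<Sum>x | x \<in> UNIV - {0} \<and> x * \<eta> x = t. \<chi> (c * (x * \<eta> x)))"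
    by (rule sum.image_gen) simp
  also have "\<dots> = (\<Sum>t\<in>(\<lambda>x. x * \<eta> x) ` (UNIV - {0}). of_nat (q + 1) * \<chi> (c * t))"
  proof (rule sum.cong)
    fix t assume "t \<in> (\<lambda>x. x * \<eta> x) ` (UNIV - {0})"
    then obtain w where w: "w \<noteq> 0" "t = w * \<eta> w" by auto
    have "card {x. x \<noteq> 0 \<and> x * \<eta> x = w * \<eta> w} = card {x. x \<noteq> 0 \<and> x * \<eta> x = 1}"
      by (rule card_kernel_image_units) (auto simp: w)
    then have card: "card {x. x \<in> UNIV - {0} \<and> x * \<eta> x = t} = q + 1"
      by (simp add: card_norm_one w(2))
    have "(\<Sum>x | x \<in> UNIV - {0} \<and> x * \<eta> x = t. \<chi> (c * (x * \<eta> x)))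
        = (\<Sum>x | x \<in> UNIV - {0} \<and> x * \<eta> x = t. \<chi> (c * t))"
      by (rule sum.cong) auto
    then show "(\<Sum>x | x \<in> UNIV - {0} \<and> x * \<eta> x = t. \<chi> (c * (x * \<eta> x))) = of_nat (q + 1) * \<chi> (c * t)"
      by (simp only: sum_constant card)
  qed simp
  also have "\<dots> = of_nat (q + 1) * (\<Sum>t\<in>{t. \<eta> t = t} - {0}. \<chi> (c * t))"
    by (simp only: norm_image sum_distrib_left)
  also have "(\<Sum>t\<in>{t. \<eta> t = t} - {0}. \<chi> (c * t)) = - 1"
    using sum_fixed_field[OF assms] by (subst sum_diff1) auto
  finally show ?thesis
    by (subst sum.remove[of _ 0]) auto
qed

text \<open>Induction splits off an anisotropic vector; if there is none, polarization gives \<open>H = 0\<close>.\<close>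

lemma gauss_sum:
  fixes scale :: "'k \<Rightarrow> 'u::ab_group_add \<Rightarrow> 'u" and H :: "'u \<Rightarrow> 'u \<Rightarrow> 'k"
  assumes "vector_space scale" and "finite W" and "module.subspace scale W"
    and "\<And>u v w. u \<in> W \<Longrightarrow> v \<in> W \<Longrightarrow> w \<in> W \<Longrightarrow> H (u + v) w = H u w + H v w"
    and "\<And>c u v. u \<in> W \<Longrightarrow> v \<in> W \<Longrightarrow> H (scale c u) v = c * H u v"
    and "\<And>u v. u \<in> W \<Longrightarrow> v \<in> W \<Longrightarrow> H v u = - \<eta> (H u v)"
  shows "\<exists>m. card W * card {u \<in> W. \<forall>v\<in>W. H u v = 0} = q ^ (2 * m) \<and>
           (\<Sum>u\<in>W. \<chi> (H u u)) = (- of_nat q) ^ m"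
  using assms(2-)
proof (induction "card W" arbitrary: W rule: less_induct)
  case less
  interpret vector_space scale by (rule assms(1))
  note W = less.prems(2)
  note add = less.prems(3) and hom = less.prems(4) and skew = less.prems(5)
  note closed = subspace_add[OF W] subspace_scale[OF W] subspace_diff[OF W]
  have hom2: "H u (scale c v) = \<eta> c * H u v" if "u \<in> W" "v \<in> W" for c u v
    using skew[of "scale c v" u] hom[of v u c] skew[of u v] that closed by simp
  have add2: "H u (v + w) = H u v + H u w" if "u \<in> W" "v \<in> W" "w \<in> W" for u v w
    using skew[of "v + w" u] add[of v w u] skew[of v u] skew[of w u] that closed by simp
  show ?case
  proof (cases "\<exists>u\<in>W. H u u \<noteq> 0")
    case False
    have "H u v = 0" if uv: "u \<in> W" "v \<in> W" for u v
    proof (rule ccontr)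
      assume nz: "H u v \<noteq> 0"
      \<comment> \<open>This is the vanishing of \<open>H\<close> on the diagonal at
        \<open>scale c u + v\<close>. As \<open>c\<close> varies, \<open>c * H u v\<close> runs
        through all of K, so \<open>\<eta>\<close> would be trivial.\<close>
      have *: "c * H u v = \<eta> (c * H u v)" for c
      proof -
        have "H (scale c u + v) (scale c u + v) = 0"
          using False uv closed by blast
        then show ?thesis
          using False uv closed skew[of u v] by (simp add: add add2 hom hom2)
      qed
      have "x = \<eta> x" for x
        using *[of "x / H u v"] nz by simp
      then show False
        using nontrivial_ex by metis
    qed
    then have rad: "{u \<in> W. \<forall>v\<in>W. H u v = 0} = W" and H: "H u u = 0" if "u \<in> W" for u
      using that by auto
    \<comment> \<open>Here \<open>W\<close> is its own radical and the sum is just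
      \<open>card W\<close>. The exponent is even, so this is also a power of - q, with m =
      \<open>2 * dim W\<close>.\<close>
    have card: "card W = q ^ (2 * dim W)"
      using card_subspace[OF W \<open>finite W\<close>] by (simp add: card_field power_mult)
    have "card W * card W = q ^ (2 * (2 * dim W))"
      unfolding card by (simp flip: power_add)
    moreover have "(\<Sum>u\<in>W. \<chi> (H u u)) = (- of_nat q) ^ (2 * dim W)"
      using False by (simp add: card power_mult)
    moreover have "{u \<in> W. \<forall>v\<in>W. H u v = 0} = W"
      using rad[OF subspace_0[OF W]] .
    ultimately show ?thesis
      by (intro exI[of _ "2 * dim W"]) (simp only: simp_thms)
  next
    case True
    then obtain u where u: "u \<in> W" "H u u \<noteq> 0" by blast
    define W' where "W' = {w \<in> W. H w u = 0}"
    have H0: "H 0 v = 0" if "v \<in> W" for v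
      using hom[of 0 v 0] that subspace_0[OF W] by simp
    have W': "subspace W'"
      using W u by (auto simp: W'_def subspace_def add hom H0)
    have sub: "W' \<subseteq> W"
      by (auto simp: W'_def)
    have perp: "H w u = 0" "H u w = 0" if "w \<in> W'" for w
      using that skew[of w u] u by (auto simp: W'_def)
    define r where "r w = w - scale (H w u / H u u) u" for w
    have dff: "H (w - scale c u) u = H w u - c * H u u" if "w \<in> W" for w c
      using add[of "w - scale c u" "scale c u" u] that u closed hom by (simp add: algebra_simps)
    have r: "r w \<in> W'" if "w \<in> W" for w
      unfolding W'_def r_def using that u closed by (auto simp: dff)
    have bij: "bij_betw (\<lambda>(c, w). scale c u + w) (UNIV \<times> W') W"
    proof (rule bij_betwI[where g = "\<lambda>w. (H w u / H u u, r w)"])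
      show "(\<lambda>(c, w). scale c u + w) \<in> UNIV \<times> W' \<rightarrow> W"
        using sub u closed by auto
      show "(\<lambda>w. (H w u / H u u, r w)) \<in> W \<rightarrow> UNIV \<times> W'"
        using r by auto
      show "(case (H w u / H u u, r w) of (c, w) \<Rightarrow> scale c u + w) = w" if "w \<in> W" for w
        by (simp add: r_def)
      fix y assume "y \<in> (UNIV :: 'k set) \<times> W'"
      then obtain c w where y: "y = (c, w)" "w \<in> W'" by auto
      then have "H (scale c u + w) u = c * H u u"
        using u sub perp closed by (auto simp: add hom)
      then show "(case (case y of (c, w) \<Rightarrow> scale c u + w) of w \<Rightarrow> (H w u / H u u, r w)) = y"
        using u by (simp add: y r_def)
    qed
    have card: "card W = q ^ 2 * card W'"
      using bij_betw_same_card[OF bij] by (simp add: card_cartesian_product card_field)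
    have fin: "finite W'"
      by (rule finite_subset[OF sub less.prems(1)])
    then have "card W' \<noteq> 0"
      using subspace_0[OF W'] by auto
    then have lt: "card W' < card W"
      using one_less_power[OF q_gt_1, of 2] by (simp add: card)
    have "\<exists>m. card W' * card {x \<in> W'. \<forall>v\<in>W'. H x v = 0} = q ^ (2 * m) \<and>
           (\<Sum>x\<in>W'. \<chi> (H x x)) = (- of_nat q) ^ m"
      by (rule less.hyps[OF lt fin W']) (use sub in \<open>auto intro: add hom skew\<close>)
    then obtain m where m: "card W' * card {x \<in> W'. \<forall>v\<in>W'. H x v = 0} = q ^ (2 * m)"
      "(\<Sum>x\<in>W'. \<chi> (H x x)) = (- of_nat q) ^ m" by blast
    have rad: "{x \<in> W. \<forall>v\<in>W. H x v = 0} = {x \<in> W'. \<forall>v\<in>W'. H x v = 0}"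
    proof (intro subset_antisym subsetI)
      fix x assume x: "x \<in> {x \<in> W'. \<forall>v\<in>W'. H x v = 0}"
      have "H x v = 0" if "v \<in> W" for v
      proof -
        have "H x v = H x (scale (H v u / H u u) u + r v)"
          by (simp add: r_def)
        also have "\<dots> = \<eta> (H v u / H u u) * H x u + H x (r v)"
          using x u sub r[OF that] closed by (subst add2) (auto simp: hom2 subset_iff)
        finally show ?thesis
          using x perp(1)[of x] r[OF that] by simp
      qed
      then show "x \<in> {x \<in> W. \<forall>v\<in>W. H x v = 0}"
        using x sub by auto
    qed (use u in \<open>auto simp: W'_def\<close>)
    have "(\<Sum>x\<in>W. \<chi> (H x x)) = (\<Sum>(c, w)\<in>UNIV \<times> W'. \<chi> (H (scale c u + w) (scale c u + w)))"
      using sum.reindex_bij_betw[OF bij, of "\<lambda>x. \<chi> (H x x)"] by (simp add: case_prod_unfold)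
    also have "\<dots> = (\<Sum>(c, w)\<in>UNIV \<times> W'. \<chi> (H u u * (c * \<eta> c)) * \<chi> (H w w))"
    proof (rule sum.cong)
      fix y assume "y \<in> (UNIV :: 'k set) \<times> W'"
      then obtain c w where y: "y = (c, w)" "w \<in> W'" by auto
      then have "H (scale c u + w) (scale c u + w) = H u u * (c * \<eta> c) + H w w"
        using u sub perp closed by (auto simp: add hom add2 hom2 subset_iff)
      then show "(case y of (c, w) \<Rightarrow> \<chi> (H (scale c u + w) (scale c u + w)))
          = (case y of (c, w) \<Rightarrow> \<chi> (H u u * (c * \<eta> c)) * \<chi> (H w w))"
        by (simp add: y \<chi>_add)
    qed simp
    also have "\<dots> = (\<Sum>c\<in>UNIV. \<chi> (H u u * (c * \<eta> c))) * (\<Sum>w\<in>W'. \<chi> (H w w))"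
      by (simp add: sum_product sum.cartesian_product)
    also have "(\<Sum>c\<in>UNIV. \<chi> (H u u * (c * \<eta> c))) = - of_nat q"
      using u skew[of u u] by (intro sum_norm) (metis minus_minus)+
    finally have "(\<Sum>x\<in>W. \<chi> (H x x)) = (- of_nat q) ^ Suc m"
      by (simp add: m(2))
    \<comment> \<open>Splitting off the anisotropic line costs a factor \<open>q ^ 2\<close> in
      \<open>card W\<close> and nothing in the radical, in step with one factor - q in the
      sum.\<close>
    moreover have "card W * card {x \<in> W. \<forall>v\<in>W. H x v = 0} = q ^ (2 * Suc m)"
      unfolding rad card using m(1) by (simp add: power2_eq_square mult.assoc)
    ultimately show ?thesis by blast
  qed
qed

end

subsection \<open>Schur's lemma and the central character\<close>

text \<open>A finite orbit takes the place of a characteristic polynomial: a repetition in it means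
  that some X^i - X^j annihilates \<open>v\<close>. Linear factors X - r are then removed from an
  annihilating polynomial g = (X - r) h. Either h already annihilates \<open>v\<close>, with smaller
  degree, or h(T) v is an eigenvector for r.\<close>

lemma exists_eigenvector:
  fixes scale :: "'k::alg_closed_field \<Rightarrow> 'v::ab_group_add \<Rightarrow> 'v"
  assumes T: "Vector_Spaces.linear scale scale T"
    and W: "module.subspace scale W" "\<And>w. w \<in> W \<Longrightarrow> T w \<in> W"
    and v: "v \<in> W" "v \<noteq> 0" and fin: "finite (range (\<lambda>i. (T ^^ i) v))"
  shows "\<exists>r. \<exists>w\<in>W. w \<noteq> 0 \<and> T w = scale r w"
proof -
  interpret T: Vector_Spaces.linear scale scale T by fact
  note subspace_simps = T.vs1.subspace_sum T.vs1.subspace_scale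
  have mem: "(T ^^ i) v \<in> W" for i
    by (induction i) (simp_all add: v W(2))
  have root: "\<exists>r. \<exists>w\<in>W. w \<noteq> 0 \<and> T w = scale r w"
    if "g \<noteq> 0" "degree g < n" "(\<Sum>i<n. scale (coeff g i) ((T ^^ i) v)) = 0" for g n
    using that
  proof (induction n arbitrary: g)
    case (Suc n)
    show ?case
    proof (cases "degree g = 0")
      case True
      then have "(\<Sum>i<Suc n. scale (coeff g i) ((T ^^ i) v)) = (\<Sum>i\<in>{0}. scale (coeff g i) ((T ^^ i) v))"
        by (intro sum.mono_neutral_right) (auto simp: coeff_eq_0)
      then have "coeff g 0 = 0"
        using Suc.prems(3) v(2) by simp
      with True Suc.prems(1) show ?thesis
        using leading_coeff_neq_0 by metis
    next
      case False
      then obtain r where "poly g r = 0"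
        using alg_closed_imp_poly_has_root[of g] by auto
      then obtain h where h: "g = [:- r, 1:] * h"
        by (auto simp: poly_eq_0_iff_dvd elim: dvdE)
      have "h \<noteq> 0"
        using Suc.prems(1) h by auto
      then have deg: "degree h < n"
        using Suc.prems(2) unfolding h by (subst (asm) degree_mult_eq) auto
      define u where "u = (\<Sum>i<n. scale (coeff h i) ((T ^^ i) v))"
      have "u \<in> W"
        unfolding u_def using mem by (intro subspace_simps W(1)) auto
      have Tu: "T u = (\<Sum>i<n. scale (coeff h i) ((T ^^ Suc i) v))"
        by (simp add: u_def T.sum T.scale)
      \<comment> \<open>This is g(T) v = T (h(T) v) - r h(T) v, written in coefficients;
        \<open>pCons 0 h\<close> is X times h.\<close>
      have "0 = (\<Sum>i<Suc n. scale (coeff (pCons 0 h) i) ((T ^^ i) v) - scale (r * coeff h i) ((T ^^ i) v))"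
        using Suc.prems(3) by (simp add: h T.vs1.scale_left_diff_distrib del: sum.lessThan_Suc)
      also have "\<dots> = (\<Sum>i<Suc n. scale (coeff (pCons 0 h) i) ((T ^^ i) v))
          - scale r (\<Sum>i<Suc n. scale (coeff h i) ((T ^^ i) v))"
        by (simp add: sum_subtractf T.vs1.scale_sum_right del: sum.lessThan_Suc)
      also have "(\<Sum>i<Suc n. scale (coeff h i) ((T ^^ i) v)) = u"
        using deg by (simp add: u_def coeff_eq_0)
      also have "(\<Sum>i<Suc n. scale (coeff (pCons 0 h) i) ((T ^^ i) v)) = T u"
        by (subst sum.lessThan_Suc_shift) (simp add: Tu)
      finally have eig: "T u = scale r u"
        by simp
      show ?thesis
      proof (cases "u = 0")
        case True
        then show ?thesis
          using Suc.IH[OF \<open>h \<noteq> 0\<close> deg] by (simp add: u_def)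
      next
        case False
        then show ?thesis
          using eig \<open>u \<in> W\<close> by blast
      qed
    qed
  qed simp
  have "\<not> inj (\<lambda>i. (T ^^ i) v)"
    using fin finite_imageD infinite_UNIV_nat by blast
  then obtain i j where ij: "i \<noteq> j" "(T ^^ i) v = (T ^^ j) v"
    by (auto simp: inj_on_def)
  define g where "g = monom 1 i - monom (1::'k) j"
  have "coeff g i = 1"
    using ij(1) by (simp add: g_def)
  then have "g \<noteq> 0"
    by auto
  moreover have deg: "degree g < Suc (max i j)"
    unfolding g_def less_Suc_eq_le
    by (rule degree_diff_le) (auto intro: order_trans[OF degree_monom_le])
  moreover have "(\<Sum>k<Suc (max i j). scale (coeff g k) ((T ^^ k) v)) = 0"
  proof -
    have "(\<Sum>k<Suc (max i j). scale (coeff g k) ((T ^^ k) v))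
        = (\<Sum>k\<in>{i, j}. scale (coeff g k) ((T ^^ k) v))"
      by (intro sum.mono_neutral_right) (auto simp: g_def)
    then show ?thesis
      using ij by (simp add: g_def)
  qed
  ultimately show ?thesis
    by (rule root)
qed

lemma vector_space_fun: "vector_space (\<lambda>k (\<phi> :: 'w \<Rightarrow> 'a::field) b. k * \<phi> b)"
  by unfold_locales (auto simp: fun_eq_iff algebra_simps)

section \<open>Scalar extension to the algebraic closure, and Schur's lemma\<close>

context finite_dimensional_vector_space
begin

abbreviation ext_scale :: "'a alg_closure \<Rightarrow> ('b \<Rightarrow> 'a alg_closure) \<Rightarrow> 'b \<Rightarrow> 'a alg_closure" where
  "ext_scale \<equiv> \<lambda>k \<phi> b. k * \<phi> b"

abbreviation unit_fun :: "'b \<Rightarrow> 'b \<Rightarrow> 'a alg_closure" where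
  "unit_fun b \<equiv> (\<lambda>c. if c = b then 1 else 0)"

lemma linear_ext_map:
  "Vector_Spaces.linear ext_scale ext_scale (ext_map scale Basis g)"
  unfolding Vector_Spaces.linear_iff
  by (auto simp: ext_map_def fun_eq_iff vector_space_fun distrib_right sum.distrib sum_distrib_left mult.assoc)

lemma subspace_ext_space: "module.subspace ext_scale (ext_space Basis)"
proof -
  interpret ext: vector_space ext_scale by (rule vector_space_fun)
  show ?thesis
    by (auto simp: ext.subspace_def ext_space_def)
qed

lemma ext_map_in_ext_space: "ext_map scale Basis g \<phi> \<in> ext_space Basis"
  using representation_ne_zero[of Basis] by (fastforce simp: ext_map_def ext_space_def intro: sum.neutral)

lemma unit_fun_in_ext_space: "b \<in> Basis \<Longrightarrow> unit_fun b \<in> ext_space Basis"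
  by (auto simp: ext_space_def)

lemma ext_map_unit_fun:
  assumes "b \<in> Basis"
  shows "ext_map scale Basis g (unit_fun b) = (\<lambda>c. to_ac (representation Basis (g b) c))"
proof
  fix c
  have "ext_map scale Basis g (unit_fun b) c
      = (\<Sum>d\<in>Basis. if d = b then to_ac (representation Basis (g d) c) else 0)"
    unfolding ext_map_def by (intro sum.cong) auto
  then show "ext_map scale Basis g (unit_fun b) c = to_ac (representation Basis (g b) c)"
    using assms finite_Basis by simp
qed

lemma ext_map_fcomp:
  assumes h: "Vector_Spaces.linear scale scale h"
  shows "ext_map scale Basis (fcomp g h) \<phi> = ext_map scale Basis h (ext_map scale Basis g \<phi>)"
proof
  fix c
  interpret h: Vector_Spaces.linear scale scale h by fact
  have rep: "representation Basis (h v) c = (\<Sum>d\<in>Basis. representation Basis v d * representation Basis (h d) c)" for v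
  proof -
    have "h v = h (\<Sum>d\<in>Basis. scale (representation Basis v d) d)"
      using sum_representation_eq[OF independent_Basis _ finite_Basis subset_refl] span_Basis by simp
    also have "\<dots> = (\<Sum>d\<in>Basis. scale (representation Basis v d) (h d))"
      by (simp add: h.sum h.scale)
    finally have "h v = (\<Sum>d\<in>Basis. scale (representation Basis v d) (h d))" .
    then show ?thesis
      using independent_Basis span_Basis by (simp add: representation_sum representation_scale)
  qed
  have "ext_map scale Basis (fcomp g h) \<phi> c
      = (\<Sum>b\<in>Basis. \<Sum>d\<in>Basis. \<phi> b * (to_ac (representation Basis (g b) d) * to_ac (representation Basis (h d) c)))"
    by (simp add: ext_map_def fcomp_apply rep[of "g _"] to_ac_sum sum_distrib_left)
  also have "\<dots> = ext_map scale Basis h (ext_map scale Basis g \<phi>) c"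
    by (subst sum.swap) (simp add: ext_map_def sum_distrib_left sum_distrib_right mult.assoc)
  finally show "ext_map scale Basis (fcomp g h) \<phi> c = ext_map scale Basis h (ext_map scale Basis g \<phi>) c" .
qed

text \<open>Descent of the eigenvalue: \<open>r\<close> is a diagonal matrix entry of
  \<open>g\<close>, hence already lies in the ground field.\<close>

lemma ext_map_scalar:
  assumes g: "Vector_Spaces.linear scale scale g"
    and r: "\<And>\<phi>. \<phi> \<in> ext_space Basis \<Longrightarrow> ext_map scale Basis g \<phi> = ext_scale r \<phi>"
  shows "\<exists>k. g = scale k"
proof (cases "Basis = {}")
  \<comment> \<open>No diagonal entry is available over an empty basis, but the space is then zero
    and any scalar will do.\<close>
  case True
  then have "(UNIV :: 'b set) = {0}"
    using span_Basis by simp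
  then have "v = 0" for v :: 'b
    by (metis UNIV_I singletonD)
  then have "g v = scale 0 v" for v
    by metis
  then show ?thesis
    by blast
next
  case False
  then obtain b0 where b0: "b0 \<in> Basis" by blast
  interpret g: Vector_Spaces.linear scale scale g by fact
  define k where "k = representation Basis (g b0) b0"
  have rep: "to_ac (representation Basis (g b) c) = r * unit_fun b c" if "b \<in> Basis" for b c
    using r[OF unit_fun_in_ext_space[OF that]] ext_map_unit_fun[OF that] by metis
  have r': "r = to_ac k"
    using rep[OF b0, of b0] by (simp add: k_def)
  have "representation Basis (g b) = representation Basis (scale k b)" if "b \<in> Basis" for b
  proof
    fix c
    have "to_ac (representation Basis (g b) c) = to_ac (k * (if c = b then 1 else 0))"
      unfolding rep[OF that] r' by simp
    then have "representation Basis (g b) c = k * (if c = b then 1 else 0)"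
      by (simp only: to_ac_eq_iff)
    also have "\<dots> = representation Basis (scale k b) c"
      using independent_Basis span_Basis that by (simp add: representation_scale representation_basis)
    finally show "representation Basis (g b) c = representation Basis (scale k b) c" .
  qed
  then have basis: "g b = scale k b" if "b \<in> Basis" for b
    using that sum_representation_eq[OF independent_Basis _ finite_Basis subset_refl] span_Basis by (metis UNIV_I)
  have "g v = scale k v" for v
  proof -
    interpret p: vector_space_pair scale scale by unfold_locales
    show ?thesis
      by (rule p.linear_eq_on[OF g linear_scale_self _ basis]) (simp_all add: span_Basis)
  qed
  then show ?thesis by blast
qed

text \<open>An eigenspace of an operator commuting with \<open>A\<close> is invariant under
  \<open>A\<close>, hence everything. The orbit condition \<open>fin\<close> supplies the
  eigenvector over the closure, and \<open>ext_map_scalar\<close> brings the scalar back to the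
  ground field.\<close>

lemma schur:
  assumes irr: "irreducible_on ext_scale (ext_space Basis) A"
    and A: "\<And>a. a \<in> A \<Longrightarrow> Vector_Spaces.linear ext_scale ext_scale a"
      "\<And>a \<phi>. a \<in> A \<Longrightarrow> \<phi> \<in> ext_space Basis \<Longrightarrow> a \<phi> \<in> ext_space Basis"
    and comm: "\<And>a \<phi>. a \<in> A \<Longrightarrow> \<phi> \<in> ext_space Basis \<Longrightarrow>
      ext_map scale Basis g (a \<phi>) = a (ext_map scale Basis g \<phi>)"
    and fin: "\<And>\<phi>. finite (range (\<lambda>i. (ext_map scale Basis g ^^ i) \<phi>))"
    and g: "Vector_Spaces.linear scale scale g"
  shows "\<exists>k. g = scale k"
proof -
  interpret ext: vector_space ext_scale by (rule vector_space_fun)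
  interpret G: Vector_Spaces.linear ext_scale ext_scale "ext_map scale Basis g"
    by (rule linear_ext_map)
  obtain \<psi> :: "'b \<Rightarrow> 'a alg_closure" where \<psi>: "\<psi> \<in> ext_space Basis" "\<psi> \<noteq> 0"
    using irr ext.subspace_0[OF subspace_ext_space] unfolding irreducible_on_def by blast
  obtain r \<psi>' where \<psi>': "\<psi>' \<in> ext_space Basis" "\<psi>' \<noteq> 0" "ext_map scale Basis g \<psi>' = ext_scale r \<psi>'"
    using exists_eigenvector[OF linear_ext_map subspace_ext_space ext_map_in_ext_space \<psi> fin] by blast
  define U where "U = {\<phi> \<in> ext_space Basis. ext_map scale Basis g \<phi> = ext_scale r \<phi>}"
  have "ext.subspace U"
  proof (rule ext.subspaceI)
    show "0 \<in> U"
      using ext.subspace_0[OF subspace_ext_space] by (simp add: U_def G.zero) (simp add: zero_fun_def)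
    show "\<phi> + \<psi> \<in> U" if "\<phi> \<in> U" "\<psi> \<in> U" for \<phi> \<psi>
      using that ext.subspace_add[OF subspace_ext_space]
      by (simp add: U_def G.add) (simp add: plus_fun_def distrib_left)
    show "ext_scale c \<phi> \<in> U" if "\<phi> \<in> U" for c \<phi>
    proof -
      have "ext_map scale Basis g (ext_scale c \<phi>) = ext_scale c (ext_map scale Basis g \<phi>)"
        by (rule G.scale)
      also have "\<dots> = ext_scale r (ext_scale c \<phi>)"
        using that by (simp add: U_def mult.left_commute)
      finally show ?thesis
        using that ext.subspace_scale[OF subspace_ext_space] by (simp add: U_def)
    qed
  qed
  moreover have "a ` U \<subseteq> U" if "a \<in> A" for a
  proof -
    interpret a: Vector_Spaces.linear ext_scale ext_scale a by (rule A(1)[OF that])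
    show ?thesis
      using that by (auto simp: U_def A(2) comm a.scale)
  qed
  moreover have "U \<subseteq> ext_space Basis"
    by (auto simp: U_def)
  moreover have "U \<noteq> {0}"
    using \<psi>' by (auto simp: U_def)
  ultimately have "U = ext_space Basis"
    using irr unfolding irreducible_on_def by blast
  then show ?thesis
    by (intro ext_map_scalar[OF g, of r]) (auto simp: U_def)
qed

lemma ext_map_scale:
  assumes "\<phi> \<in> ext_space Basis"
  shows "ext_map scale Basis (scale k) \<phi> = ext_scale (to_ac k) \<phi>"
proof
  fix c
  have "ext_map scale Basis (scale k) \<phi> c = (\<Sum>b\<in>Basis. if b = c then to_ac k * \<phi> b else 0)"
    unfolding ext_map_def using independent_Basis span_Basis
    by (intro sum.cong) (auto simp: representation_scale representation_basis)
  also have "\<dots> = to_ac k * \<phi> c"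
    using assms finite_Basis by (auto simp: ext_space_def)
  finally show "ext_map scale Basis (scale k) \<phi> c = to_ac k * \<phi> c" .
qed

text \<open>A coordinate hyperplane is stable under scalars, and it is nonzero and proper in
  dimension above 1. This is what excludes a trivial central character.\<close>

lemma not_irreducible_scalars:
  assumes dim: "card Basis > 1"
    and A: "\<And>a. a \<in> A \<Longrightarrow> \<exists>k. \<forall>\<phi>\<in>ext_space Basis. a \<phi> = ext_scale k \<phi>"
  shows "\<not> irreducible_on ext_scale (ext_space Basis) A"
proof
  assume irr: "irreducible_on ext_scale (ext_space Basis) A"
  interpret ext: vector_space ext_scale by (rule vector_space_fun)
  obtain b0 b1 where b: "b0 \<in> Basis" "b1 \<in> Basis" "b0 \<noteq> b1"
    using dim by (metis card_le_Suc0_iff_eq finite_Basis One_nat_def not_less)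
  define U :: "('b \<Rightarrow> 'a alg_closure) set" where "U = {\<phi> \<in> ext_space Basis. \<phi> b0 = 0}"
  have "ext.subspace U"
    using ext.subspace_0[OF subspace_ext_space] ext.subspace_add[OF subspace_ext_space]
      ext.subspace_scale[OF subspace_ext_space]
    by (auto intro!: ext.subspaceI simp: U_def)
  moreover have "a ` U \<subseteq> U" if "a \<in> A" for a
    using A[OF that] ext.subspace_scale[OF subspace_ext_space] by (auto simp: U_def)
  moreover have "U \<subseteq> ext_space Basis"
    by (auto simp: U_def)
  ultimately have "U = {0} \<or> U = ext_space Basis"
    using irr unfolding irreducible_on_def by blast
  moreover have "unit_fun b1 \<in> U" "unit_fun b1 \<noteq> 0"
    using b unit_fun_in_ext_space[of b1] by (auto simp: U_def fun_eq_iff)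
  moreover have "unit_fun b0 \<notin> U"
    by (simp add: U_def)
  ultimately show False
    using unit_fun_in_ext_space[OF b(1)] by blast
qed

end

text \<open>Elements commuting with the whole image act by scalars. If the centre acted trivially,
  the image would be abelian, so every \<open>\<rho> x\<close> would be a scalar, contrary to
  irreducibility in degree above 1.\<close>

lemma extraspecial_central_character:
  fixes scale :: "'l::field \<Rightarrow> 'w::ab_group_add \<Rightarrow> 'w"
    and f :: "'v::ab_group_add \<Rightarrow> 'v \<Rightarrow> 'z::ab_group_add"
  assumes f: "\<And>x. f 0 x = 0" "\<And>x. f x 0 = 0"
    and fin: "finite (UNIV :: ('v \<times> 'z) set)"
    and rho: "\<rho> \<in> hom (extraspecial_group f) (general_linear scale)"
    and irr: "absolutely_irreducible scale (extraspecial_group f) \<rho>"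
    and dim: "vector_space.dim scale UNIV > 1"
  obtains \<theta> where "\<And>t. \<rho> (0, t) = scale (\<theta> t)" "\<And>s t. \<theta> (s + t) = \<theta> s * \<theta> t" "\<theta> 0 = 1" "\<exists>t. \<theta> t \<noteq> 1"
proof -
  obtain B where B: "finite_dimensional_vector_space scale B"
    and irr: "irreducible_on (\<lambda>k \<phi> b. k * \<phi> b) (ext_space B :: ('w \<Rightarrow> 'l alg_closure) set)
          ((\<lambda>x. ext_map scale B (\<rho> x)) ` UNIV)"
    using irr unfolding absolutely_irreducible_def extraspecial_group_def by auto
  interpret W: finite_dimensional_vector_space scale B by (rule B)
  have lin: "Vector_Spaces.linear scale scale (\<rho> x)" and bij: "bij (\<rho> x)" for x
    using hom_in_carrier[OF rho, of x] by (simp_all add: extraspecial_group_def general_linear_def)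
  have mult: "fcomp (\<rho> (x, s)) (\<rho> (y, t)) = \<rho> (x + y, s + t + f x y)" for x y s t
    using hom_mult[OF rho, of "(x, s)" "(y, t)"] by (simp add: extraspecial_group_def general_linear_def)
  have card: "card B > 1"
    using dim by simp
  have mult_ex: "\<exists>z. fcomp (\<rho> x) (\<rho> y) = \<rho> z" for x y
    using mult[of "fst x" "snd x" "fst y" "snd y"] by auto
  have scalar: "\<exists>k. \<rho> x = scale k" if comm: "\<And>y. fcomp (\<rho> x) (\<rho> y) = fcomp (\<rho> y) (\<rho> x)" for x
  proof (rule W.schur[OF irr])
    show "finite (range (\<lambda>i. (ext_map scale B (\<rho> x) ^^ i) \<phi>))" for \<phi>
    proof (rule finite_subset)
      \<comment> \<open>Positive powers come from elements of the finite group. The vector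
        \<open>\<phi>\<close> itself is adjoined because it may lie outside the extended space,
        where the group identity need not fix it.\<close>
      have "(ext_map scale B (\<rho> x) ^^ i) \<phi> \<in> insert \<phi> (range (\<lambda>y. ext_map scale B (\<rho> y) \<phi>))" for i
      proof (induction i)
        case (Suc i)
        have "ext_map scale B (\<rho> x) (ext_map scale B (\<rho> y) \<phi>) \<in> range (\<lambda>y. ext_map scale B (\<rho> y) \<phi>)" for y
          using mult_ex[of y x] W.ext_map_fcomp[OF lin, of "\<rho> y" x \<phi>] by (metis rangeI)
        with Suc show ?case by auto
      qed simp
      then show "range (\<lambda>i. (ext_map scale B (\<rho> x) ^^ i) \<phi>)
          \<subseteq> insert \<phi> (range (\<lambda>y. ext_map scale B (\<rho> y) \<phi>))"
        by blast
    qed (use fin in simp)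
    fix a \<phi> assume "a \<in> range (\<lambda>x. ext_map scale B (\<rho> x))"
    then obtain y where a: "a = ext_map scale B (\<rho> y)" by blast
    show "ext_map scale B (\<rho> x) (a \<phi>) = a (ext_map scale B (\<rho> x) \<phi>)"
      unfolding a W.ext_map_fcomp[OF lin, symmetric] comm ..
  qed (auto simp: W.linear_ext_map W.ext_map_in_ext_space lin)
  have "\<exists>k. \<rho> (0, t) = scale k" for t
  proof (rule scalar)
    show "fcomp (\<rho> (0, t)) (\<rho> y) = fcomp (\<rho> y) (\<rho> (0, t))" for y
      using mult[of 0 t "fst y" "snd y"] mult[of "fst y" "snd y" 0 t] by (simp add: f add.commute)
  qed
  then obtain \<theta> where \<theta>: "\<rho> (0, t) = scale (\<theta> t)" for t
    by metis
  obtain w :: 'w where w: "w \<noteq> 0"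
  proof -
    have "B \<noteq> {}" using card by auto
    then show ?thesis
      using W.independent_Basis W.dependent_zero that by (metis ex_in_conv)
  qed
  have add: "\<theta> (s + t) = \<theta> s * \<theta> t" for s t
  proof -
    have "scale (\<theta> (s + t)) w = scale (\<theta> s * \<theta> t) w"
      using fun_cong[OF mult[of 0 s 0 t], of w] by (auto simp: \<theta> f fcomp_apply mult.commute)
    then show ?thesis
      using w by simp
  qed
  have "\<theta> 0 \<noteq> 0"
  proof
    assume "\<theta> 0 = 0"
    then have "\<rho> (0, 0) w = \<rho> (0, 0) 0"
      by (simp add: \<theta>)
    then show False
      using w bij by (metis bij_def injD)
  qed
  then have "\<theta> 0 = 1"
    using add[of 0 0] by simp
  moreover have "\<exists>t. \<theta> t \<noteq> 1"
  proof (rule ccontr)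
    assume "\<not> ?thesis"
    then have id: "\<rho> (0, t) = id" for t
      by (simp add: \<theta> fun_eq_iff)
    \<comment> \<open>Only the central coordinates of the products (x, s)(y, t) and (y, t)(x, s) can
      differ, so independence of that coordinate makes the image commutative.\<close>
    have indep: "\<rho> (x, s) = \<rho> (x, t)" for x s t
      using mult[of x s 0 "t - s"] by (simp add: f id fcomp_def)
    have "\<exists>k. \<rho> x = scale k" for x
    proof (rule scalar)
      show "fcomp (\<rho> x) (\<rho> y) = fcomp (\<rho> y) (\<rho> x)" for y
        using mult[of "fst x" "snd x" "fst y" "snd y"] mult[of "fst y" "snd y" "fst x" "snd x"]
          indep[of "fst x + fst y"] by (simp add: add.commute[of "fst y"])
    qed
    then have "\<exists>k. \<forall>\<phi>\<in>ext_space B. a \<phi> = W.ext_scale k \<phi>"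
      if "a \<in> range (\<lambda>x. ext_map scale B (\<rho> x))" for a
      using that W.ext_map_scale by (metis rangeE)
    then show False
      using W.not_irreducible_scalars[OF card] irr by blast
  qed
  ultimately show ?thesis
    using that[of \<theta>] \<theta> add by blast
qed

subsection \<open>Isometries of a Hermitian space\<close>

locale hermitian_space =
  involution_character \<eta> \<chi> + vector_space scale
  for \<eta> :: "'k::{field,finite} \<Rightarrow> 'k" and \<chi> :: "'k \<Rightarrow> 'l::field"
    and scale :: "'k \<Rightarrow> 'v::ab_group_add \<Rightarrow> 'v" +
  fixes F :: "'v \<Rightarrow> 'v \<Rightarrow> 'k"
  assumes finite_V: "finite (UNIV :: 'v set)"
    and hermitian: "hermitian_form scale \<eta> F"
    and nondegenerate: "nondegenerate_form F"
    and q_nonzero: "of_nat q \<noteq> (0 :: 'l)"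
begin

lemma F_add_right [simp]: "F x (y + z) = F x y + F x z"
  and F_scale_right [simp]: "F x (scale c y) = \<eta> c * F x y"
  using hermitian unfolding hermitian_form_def by blast+

lemma F_sym: "F y x = \<eta> (F x y)"
  using hermitian unfolding hermitian_form_def by blast

lemma F_add_left [simp]: "F (x + y) z = F x z + F y z"
  and F_scale_left [simp]: "F (scale c x) z = c * F x z"
  using hermitian unfolding hermitian_form_def Vector_Spaces.linear_iff by blast+

lemma F_0_left [simp]: "F 0 x = 0"
  using F_scale_left[of 0 0 x] by (simp del: F_scale_left)

lemma F_0_right [simp]: "F x 0 = 0"
  using F_scale_right[of x 0 0] by (simp del: F_scale_right)

lemma F_diff_left [simp]: "F (x - y) z = F x z - F y z"
  using F_add_left[of "x - y" y z] by (simp del: F_add_left)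

lemma F_diff_right [simp]: "F x (y - z) = F x y - F x z"
  using F_add_right[of x "y - z" z] by (simp del: F_add_right)

lemma F_minus_left [simp]: "F (- x) z = - F x z"
  using F_diff_left[of 0 x z] by (simp del: F_diff_left)

lemma F_minus_right [simp]: "F x (- z) = - F x z"
  using F_diff_right[of x 0 z] by (simp del: F_diff_right)

lemma finite_set [simp]: "finite (A :: 'v set)"
  by (rule finite_subset[OF subset_UNIV finite_V])

section \<open>Orthogonal complements\<close>

definition perp :: "'v set \<Rightarrow> 'v set" where
  "perp M = {y. \<forall>x\<in>M. F x y = 0}"

lemma card_subspace_q: "subspace M \<Longrightarrow> card M = q ^ (2 * dim M)"
  by (simp add: card_subspace card_field power_mult)

lemma subspace_perp: "subspace (perp M)"
  by (auto simp: subspace_def perp_def)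

lemma card_perp: "subspace M \<Longrightarrow> card M * card (perp M) = CARD('v)"
  unfolding perp_def
  by (rule card_annihilator[OF vector_space_axioms finite_V, where \<eta> = \<eta>])
    (use nondegenerate surj_\<eta> in \<open>auto simp: nondegenerate_form_def\<close>)

lemma subset_perp_perp: "M \<subseteq> perp (perp M)"
proof
  fix x assume "x \<in> M"
  then have "F y x = 0" if "y \<in> perp M" for y
    using that F_sym[of x y] F_sym[of y x] by (auto simp: perp_def)
  then show "x \<in> perp (perp M)"
    by (auto simp: perp_def)
qed

lemma perp_perp:
  assumes "subspace M"
  shows "perp (perp M) = M"
proof (rule card_subset_eq[symmetric])
  have "card (perp M) * card (perp (perp M)) = card (perp M) * card M"
    using card_perp[OF assms] card_perp[OF subspace_perp, of M] by (simp add: mult.commute)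
  moreover have "card (perp M) \<noteq> 0"
    using subspace_0[OF subspace_perp] by auto
  ultimately show "card M = card (perp (perp M))"
    by simp
qed (simp_all add: subset_perp_perp)

text \<open>Invariance of \<open>F\<close> itself, which is what the Hermitian arguments use.
  Elements of the isometry group of f have this property because the trace is not identically zero
  and \<open>F\<close> is linear in its first argument.\<close>

definition isometry :: "('v \<Rightarrow> 'v) \<Rightarrow> bool" where
  "isometry g \<longleftrightarrow> Vector_Spaces.linear scale scale g \<and> bij g \<and> (\<forall>x y. F (g x) (g y) = F x y)"

definition fixed :: "('v \<Rightarrow> 'v) \<Rightarrow> 'v set" where
  "fixed g = {x. g x = x}"

lemma isometry_F [simp]: "isometry g \<Longrightarrow> F (g x) (g y) = F x y"
  by (simp add: isometry_def)

lemma isometry_linear: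
  assumes "isometry g"
  shows "g (x + y) = g x + g y" "g (x - y) = g x - g y" "g 0 = 0" "g (- x) = - g x"
    "g (scale c x) = scale c (g x)"
proof -
  interpret g: Vector_Spaces.linear scale scale g
    using assms by (simp add: isometry_def)
  show "g (x + y) = g x + g y" "g (x - y) = g x - g y" "g 0 = 0" "g (- x) = - g x"
    "g (scale c x) = scale c (g x)"
    by (simp_all add: g.add g.diff g.zero g.neg g.scale)
qed

lemma isometry_fcomp: "isometry g \<Longrightarrow> isometry h \<Longrightarrow> isometry (fcomp g h)"
  by (auto simp: isometry_def fcomp_comp bij_comp intro: Vector_Spaces.linear_compose)

lemma isometry_inv:
  assumes "isometry g"
  shows "isometry (inv_into UNIV g)"
proof -
  have bij: "bij g"
    using assms by (simp add: isometry_def)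
  then have inv: "g (inv_into UNIV g x) = x" "inv_into UNIV g (g x) = x" for x
    by (simp_all add: bij_is_surj bij_is_inj surj_f_inv_f)
  have "inv_into UNIV g (x + y) = inv_into UNIV g x + inv_into UNIV g y" "inv_into UNIV g (scale c x) = scale c (inv_into UNIV g x)" for x y c
    using isometry_linear[OF assms] inv by metis+
  moreover have "F (inv_into UNIV g x) (inv_into UNIV g y) = F x y" for x y
    using isometry_F[OF assms, of "inv_into UNIV g x" "inv_into UNIV g y"] by (simp add: inv)
  ultimately show ?thesis
    by (simp add: isometry_def Vector_Spaces.linear_iff vector_space_axioms bij bij_imp_bij_inv)
qed

lemma subspace_fixed: "isometry g \<Longrightarrow> subspace (fixed g)"
  by (auto simp: subspace_def fixed_def isometry_linear)

lemma subspace_image: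
  assumes "isometry g"
  shows "subspace (image_one_minus g)"
proof (rule subspaceI)
  show "0 \<in> image_one_minus g"
    unfolding image_one_minus_def by (rule range_eqI[of _ _ 0]) (simp add: isometry_linear[OF assms])
  show "u + v \<in> image_one_minus g" if uv: "u \<in> image_one_minus g" "v \<in> image_one_minus g" for u v
  proof -
    obtain x y where "u = x - g x" "v = y - g y"
      using uv by (auto simp: image_one_minus_def)
    then have "u + v = (x + y) - g (x + y)"
      by (simp add: isometry_linear[OF assms])
    then show ?thesis
      unfolding image_one_minus_def by blast
  qed
  show "scale c u \<in> image_one_minus g" if u: "u \<in> image_one_minus g" for c u
  proof -
    obtain x where "u = x - g x"
      using u by (auto simp: image_one_minus_def)
    then have "scale c u = scale c x - g (scale c x)"
      by (simp add: isometry_linear[OF assms] scale_right_diff_distrib)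
    then show ?thesis
      unfolding image_one_minus_def by blast
  qed
qed

lemma card_image_fixed:
  assumes "isometry g"
  shows "card (image_one_minus g) * card (fixed g) = CARD('v)"
proof -
  have "CARD('v) = card (range (\<lambda>x. x - g x)) * card {x \<in> UNIV. x - g x = 0}"
    by (rule card_kernel_image) (auto simp: isometry_linear[OF assms] algebra_simps)
  moreover have "{x \<in> UNIV. x - g x = 0} = fixed g"
    by (auto simp: fixed_def)
  ultimately show ?thesis
    by (simp add: image_one_minus_def)
qed

text \<open>For k fixed by g, F k (g x) = F (g k) (g x) = F k x, which gives one inclusion; both
  sides have |V| / |fixed g| elements.\<close>

lemma perp_fixed:
  assumes "isometry g"
  shows "perp (fixed g) = image_one_minus g"
proof (rule card_subset_eq[symmetric])
  show "image_one_minus g \<subseteq> perp (fixed g)"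
  proof
    fix u assume "u \<in> image_one_minus g"
    then obtain x where u: "u = x - g x"
      by (auto simp: image_one_minus_def)
    have "F k u = 0" if "k \<in> fixed g" for k
      using isometry_F[OF assms, of k x] that by (simp add: u fixed_def)
    then show "u \<in> perp (fixed g)"
      by (auto simp: perp_def)
  qed
  have "card (fixed g) \<noteq> 0"
    using subspace_0[OF subspace_fixed[OF assms]] by auto
  moreover have "card (image_one_minus g) * card (fixed g) = card (perp (fixed g)) * card (fixed g)"
    using card_image_fixed[OF assms] card_perp[OF subspace_fixed[OF assms]] by (simp add: mult.commute)
  ultimately show "card (image_one_minus g) = card (perp (fixed g))"
    by simp
qed simp

text \<open>By \<open>perp_fixed\<close> both images are orthogonal complements of fixed spaces, so
  the intersection contains the complement of the sum of the fixed spaces; \<open>perp_perp\<close>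
  then applies to that sum.\<close>

lemma perp_Int_image:
  assumes "isometry g" "isometry h" "v \<in> perp (image_one_minus g \<inter> image_one_minus h)"
  shows "\<exists>a\<in>fixed g. \<exists>b\<in>fixed h. v = a + b"
proof -
  let ?S = "{a + b |a b. a \<in> fixed g \<and> b \<in> fixed h}"
  have S: "subspace ?S"
    using assms by (intro subspace_sums subspace_fixed)
  have "fixed g \<subseteq> ?S"
    using subspace_0[OF subspace_fixed[OF assms(2)]] by force
  moreover have "fixed h \<subseteq> ?S"
    using subspace_0[OF subspace_fixed[OF assms(1)]] by force
  ultimately have "perp ?S \<subseteq> perp (fixed g) \<inter> perp (fixed h)"
    unfolding perp_def by blast
  then have "v \<in> perp (perp ?S)"
    using assms(3) unfolding perp_fixed[OF assms(1)] perp_fixed[OF assms(2)]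
    by (auto simp: perp_def)
  then show ?thesis
    unfolding perp_perp[OF S] by blast
qed

text \<open>\<open>cocycle_sum g h x\<close> is, up to the factor \<open>|V|\<^sup>2\<close>, the coefficient of \<open>\<rho> (x, 0)\<close> in \<open>s g * s h\<close>.\<close>

definition cocycle_sum :: "('v \<Rightarrow> 'v) \<Rightarrow> ('v \<Rightarrow> 'v) \<Rightarrow> 'v \<Rightarrow> 'l" where
  "cocycle_sum g h x = (\<Sum>(y, z) | y - g y + (z - h z) = x.
     \<chi> (F y (y - g y) + F z (z - h z) + F (y - g y) (z - h z)))"

text \<open>The summation variable \<open>(y, z)\<close> is translated by \<open>(t, g t)\<close>.\<close>

lemma cocycle_sum_shift:
  assumes g: "isometry g" and h: "isometry h"
  shows "cocycle_sum g h (x + (t - h (g t)))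
    = \<chi> (F t x - F x (h (g t)) + F t (t - h (g t))) * cocycle_sum g h x"
proof -
  let ?e = "\<lambda>y z. F y (y - g y) + F z (z - h z) + F (y - g y) (z - h z)"
  \<comment> \<open>The exponent changes by a quantity in which \<open>y\<close> and
    \<open>z\<close> occur only through \<open>y - g y + (z - h z)\<close>; all other terms cancel
    by invariance of \<open>F\<close>. On the summation set the change is therefore
    constant.\<close>
  have eq: "?e (y + t) (z + g t)
      = (F t (y - g y + (z - h z)) - F (y - g y + (z - h z)) (h (g t)) + F t (t - h (g t))) + ?e y z" for y z
    using isometry_F[OF g, of y t] isometry_F[OF h, of z "g t"] isometry_F[OF g, of t t]
      isometry_F[OF h, of "g t" "g t"] isometry_F[OF g, of t y] isometry_F[OF h, of "g t" z]
    by (simp add: isometry_linear[OF g] isometry_linear[OF h])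
  have "cocycle_sum g h (x + (t - h (g t)))
      = (\<Sum>(y, z) | y - g y + (z - h z) = x. \<chi> (?e (y + t) (z + g t)))"
    unfolding cocycle_sum_def
    by (rule sum.reindex_bij_witness[of _ "\<lambda>(y, z). (y + t, z + g t)" "\<lambda>(y, z). (y - t, z - g t)"])
      (auto simp: isometry_linear[OF g] isometry_linear[OF h] algebra_simps)
  also have "\<dots> = (\<Sum>(y, z) | y - g y + (z - h z) = x.
      \<chi> (F t x - F x (h (g t)) + F t (t - h (g t))) * \<chi> (?e y z))"
    by (rule sum.cong) (auto simp only: eq \<chi>_add)
  also have "\<dots> = \<chi> (F t x - F x (h (g t)) + F t (t - h (g t))) * cocycle_sum g h x"
    by (simp add: cocycle_sum_def sum_distrib_left case_prod_unfold)
  finally show ?thesis .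
qed

text \<open>The factor is the weight with which t enters s (g h), so on the image of 1 - g h the
  coefficients of s g * s h are proportional to those of s (g h).\<close>

lemma cocycle_sum_image:
  assumes "isometry g" "isometry h"
  shows "cocycle_sum g h (t - h (g t)) = \<chi> (F t (t - h (g t))) * cocycle_sum g h 0"
  using cocycle_sum_shift[OF assms, of 0 t] by simp

text \<open>Translation by a fixed vector t of g h leaves \<open>x\<close> in place and multiplies
  the sum by \<chi> (F t x - F x t). For \<open>x\<close> outside the image, which is the complement
  of the fixed space, some t makes this factor different from 1.\<close>

lemma cocycle_sum_eq_0:
  assumes g: "isometry g" and h: "isometry h" and x: "x \<notin> image_one_minus (fcomp g h)"
  shows "cocycle_sum g h x = 0"
proof -
  have gh: "isometry (fcomp g h)"
    using g h by (rule isometry_fcomp)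
  obtain k where k: "h (g k) = k" "F k x \<noteq> 0"
    using x unfolding perp_fixed[OF gh, symmetric] by (auto simp: perp_def fixed_def)
  obtain u where u: "\<eta> u \<noteq> u"
    using nontrivial_ex by blast
  obtain t where t: "\<eta> t = t" "\<chi> ((u - \<eta> u) * t) \<noteq> 1"
    using \<chi>_skew[of "u - \<eta> u"] u by auto
  \<comment> \<open>Scaled so that \<open>F ?k x = t * u\<close>. As \<open>t\<close> is fixed by
    \<open>\<eta>\<close>, the exponent \<open>F ?k x - F x ?k\<close> becomes
    \<open>(u - \<eta> u) * t\<close>, a multiple of the nonzero skew element for which
    \<open>t\<close> was chosen.\<close>
  let ?k = "scale (t * u / F k x) k"
  have "h (g ?k) = ?k"
    using k(1) by (simp add: isometry_linear[OF g] isometry_linear[OF h])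
  then have "cocycle_sum g h x = \<chi> (F ?k x - F x ?k) * cocycle_sum g h x"
    using cocycle_sum_shift[OF g h, of x ?k] by simp
  moreover have "F ?k x = t * u"
    using k(2) by simp
  then have "F ?k x - F x ?k = (u - \<eta> u) * t"
    using F_sym[of x ?k] by (simp add: t algebra_simps del: F_scale_left F_scale_right)
  ultimately show ?thesis
    using t(2) by (metis mult_cancel_right1)
qed

text \<open>On the solution space y - g y equals - (z - h z), so it lies in both images; the sign is
  absorbed by replacing z with - z.\<close>

lemma sum_zero_image:
  assumes g: "isometry g" and h: "isometry h"
  shows "(\<lambda>u. fst u - g (fst u)) ` {(y, z). y - g y + (z - h z) = 0} = image_one_minus g \<inter> image_one_minus h"
    (is "_ ` ?U = _")
proof (intro subset_antisym subsetI)
  fix x assume "x \<in> (\<lambda>u. fst u - g (fst u)) ` ?U"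
  then obtain y z where yz: "x = y - g y" "y - g y + (z - h z) = 0" by auto
  then have "x = - (z - h z)"
    by (simp only: eq_neg_iff_add_eq_0)
  then have "x = - z - h (- z)"
    by (simp add: isometry_linear[OF h])
  then show "x \<in> image_one_minus g \<inter> image_one_minus h"
    using yz(1) unfolding image_one_minus_def by blast
next
  fix x assume "x \<in> image_one_minus g \<inter> image_one_minus h"
  then obtain y z where yz: "x = y - g y" "x = z - h z"
    unfolding image_one_minus_def by blast
  have "y - g y + (- z - h (- z)) = (y - g y) - (z - h z)"
    by (simp add: isometry_linear[OF h])
  also have "\<dots> = 0"
    by (simp only: yz(1)[symmetric] yz(2)[symmetric] diff_self)
  finally have "(y, - z) \<in> ?U"
    by (simp only: mem_Collect_eq prod.case)
  then show "x \<in> (\<lambda>u. fst u - g (fst u)) ` ?U"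
    using yz(1) by (force intro: image_eqI[of _ _ "(y, - z)"])
qed

lemma card_sum_zero:
  assumes g: "isometry g" and h: "isometry h"
  shows "card {(y, z). y - g y + (z - h z) = 0}
      = card (image_one_minus g \<inter> image_one_minus h) * (card (fixed g) * card (fixed h))"
proof -
  let ?U = "{(y, z). y - g y + (z - h z) = 0}" and ?\<phi> = "\<lambda>u. fst u - g (fst u)"
  have fin: "finite A" for A :: "('v \<times> 'v) set"
    by (rule finite_subset[OF subset_UNIV]) (simp add: finite_prod)
  have "card ?U = card (?\<phi> ` ?U) * card {u \<in> ?U. ?\<phi> u = 0}"
  proof (rule card_kernel_image)
    fix u v assume "u \<in> ?U" "v \<in> ?U"
    moreover have "fst (u - v) - g (fst (u - v)) + (snd (u - v) - h (snd (u - v)))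
        = (fst u - g (fst u) + (snd u - h (snd u))) - (fst v - g (fst v) + (snd v - h (snd v)))"
      by (simp add: isometry_linear[OF g] isometry_linear[OF h])
    ultimately show "u - v \<in> ?U"
      by (simp only: mem_Collect_eq case_prod_unfold diff_self)
  qed (auto simp: fin isometry_linear[OF g])
  moreover note sum_zero_image[OF g h]
  moreover have "{u \<in> ?U. ?\<phi> u = 0} = fixed g \<times> fixed h"
    by (auto simp: fixed_def)
  ultimately show ?thesis
    by (simp add: card_cartesian_product)
qed

text \<open>The map g y - z has kernel {(y, g y)} with y fixed by g h. It is onto the complement: an
  element there is a + b with a fixed by g and b fixed by h, and (a, - b) solves the equation and
  maps to a + b.\<close>

lemma card_radical:
  assumes g: "isometry g" and h: "isometry h"
  shows "card {(y, z). y - g y + (z - h z) = 0 \<and> g y - z \<in> perp (image_one_minus g \<inter> image_one_minus h)}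
      = card (perp (image_one_minus g \<inter> image_one_minus h)) * card (fixed (fcomp g h))"
proof -
  let ?P = "perp (image_one_minus g \<inter> image_one_minus h)"
  let ?R = "{(y, z). y - g y + (z - h z) = 0 \<and> g y - z \<in> ?P}" and ?\<phi> = "\<lambda>(y, z). g y - z"
  have fin: "finite A" for A :: "('v \<times> 'v) set"
    by (rule finite_subset[OF subset_UNIV]) (simp add: finite_prod)
  have "card ?R = card (?\<phi> ` ?R) * card {u \<in> ?R. ?\<phi> u = 0}"
  proof (rule card_kernel_image)
    fix u v assume "u \<in> ?R" "v \<in> ?R"
    moreover have "g (fst u) - snd u - (g (fst v) - snd v) \<in> ?P"
      if "g (fst u) - snd u \<in> ?P" "g (fst v) - snd v \<in> ?P"
      using that by (rule subspace_diff[OF subspace_perp])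
    ultimately show "u - v \<in> ?R"
      by (auto simp: isometry_linear[OF g] isometry_linear[OF h] algebra_simps)
  qed (auto simp: fin isometry_linear[OF g])
  moreover have "?\<phi> ` ?R = ?P"
  proof (intro subset_antisym subsetI)
    fix v assume v: "v \<in> ?P"
    then obtain a b where ab: "a \<in> fixed g" "b \<in> fixed h" "v = a + b"
      using perp_Int_image[OF g h] by blast
    then have mem: "(a, - b) \<in> ?R"
      using v by (simp add: fixed_def isometry_linear[OF h])
    have "v = ?\<phi> (a, - b)"
      using ab by (simp add: fixed_def)
    then show "v \<in> ?\<phi> ` ?R"
      using mem by (rule image_eqI)
  qed auto
  moreover have "bij_betw (\<lambda>y. (y, g y)) (fixed (fcomp g h)) {u \<in> ?R. ?\<phi> u = 0}"
    by (rule bij_betwI[where g = fst])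
      (auto simp: fixed_def fcomp_apply subspace_0[OF subspace_perp])
  then have "card {u \<in> ?R. ?\<phi> u = 0} = card (fixed (fcomp g h))"
    by (simp add: bij_betw_same_card)
  ultimately show ?thesis
    by simp
qed

lemma cocycle_sum_0:
  assumes g: "isometry g" and h: "isometry h"
  shows "cocycle_sum g h 0
    = (- of_nat q) ^ (dim (fixed g) + dim (fixed h) + dim (fixed (fcomp g h)) + dim (UNIV :: 'v set))"
proof -
  define scale2 where "scale2 c u = (scale c (fst u), scale c (snd u))" for c and u :: "'v \<times> 'v"
  let ?U = "{(y, z). y - g y + (z - h z) = 0}"
  \<comment> \<open>Chosen for its diagonal: with a = y - g y and z - h z = - a, the exponent of the
    cocycle sum at 0 is F y a - F z a - F a a = F (g y - z) a.\<close>
  let ?H = "\<lambda>u v. F (g (fst u) - snd u) (fst v - g (fst v))"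
  let ?J = "image_one_minus g \<inter> image_one_minus h"
  have vs: "vector_space scale2"
    by unfold_locales (auto simp: scale2_def prod_eq_iff scale_right_distrib scale_left_distrib)
  then interpret S: vector_space scale2 .
  have fin: "finite ?U"
    by (rule finite_subset[OF subset_UNIV]) (simp add: finite_prod)
  have U: "S.subspace ?U"
  proof (rule S.subspaceI)
    show "u + v \<in> ?U" if "u \<in> ?U" "v \<in> ?U" for u v
      using that by (auto simp: isometry_linear[OF g] isometry_linear[OF h] algebra_simps)
    show "scale2 c u \<in> ?U" if "u \<in> ?U" for c u
    proof -
      have "scale c (fst u - g (fst u) + (snd u - h (snd u))) = scale c 0"
        using that by auto
      then show ?thesis
        by (simp add: scale2_def isometry_linear[OF g] isometry_linear[OF h]
            scale_right_distrib scale_right_diff_distrib)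
    qed
  qed (simp add: zero_prod_def isometry_linear[OF g] isometry_linear[OF h])
  have skew: "?H v u = - \<eta> (?H u v)" if "u \<in> ?U" "v \<in> ?U" for u v
  proof -
    obtain y z y' z' where uv: "u = (y, z)" "v = (y', z')"
      by (cases u, cases v)
    define a a' b b' where "a = y - g y" "a' = y' - g y'" "b = z - h z" "b' = z' - h z'"
    note defs = this
    have ab: "a = - b" "a' = - b'"
      using that by (simp_all only: defs uv mem_Collect_eq prod.case eq_neg_iff_add_eq_0)
    \<comment> \<open>Expanding \<open>a\<close> and \<open>a'\<close> reduces this to invariance of
      \<open>F\<close> under \<open>g\<close>; the analogue for \<open>h\<close> gets the same
      right-hand side since \<open>a = - b\<close> and \<open>a' = - b'\<close>. The difference of
      the two is skewness of \<open>?H\<close>.\<close>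
    have 1: "F (g y') a + F a' (g y) = - F a' a"
      using isometry_F[OF g, of y' y] by (simp add: defs)
    have "F z' b + F b' z = F b' b"
      using isometry_F[OF h, of z' z] by (simp add: defs)
    then have "- (F z' b + F b' z) = - F b' b"
      by (rule arg_cong)
    then have 2: "F z' a + F a' z = - F a' a"
      by (simp add: ab)
    have "F (g y' - z') a + F a' (g y - z) = (F (g y') a + F a' (g y)) - (F z' a + F a' z)"
      by simp
    also have "\<dots> = 0"
      unfolding 1 2 by simp
    finally have "F (g y' - z') (y - g y) + F (y' - g y') (g y - z) = 0"
      unfolding defs .
    then show ?thesis
      using F_sym[of "g y - z" "y' - g y'"] by (simp only: uv fst_conv snd_conv involution eq_neg_iff_add_eq_0)
  qed
  have "\<exists>m. card ?U * card {u \<in> ?U. \<forall>v\<in>?U. ?H u v = 0} = q ^ (2 * m) \<and>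
           (\<Sum>u\<in>?U. \<chi> (?H u u)) = (- of_nat q) ^ m"
    by (rule gauss_sum[OF vs fin U _ _ skew])
      (auto simp: scale2_def isometry_linear[OF g] algebra_simps)
  then obtain m where m: "card ?U * card {u \<in> ?U. \<forall>v\<in>?U. ?H u v = 0} = q ^ (2 * m)"
    "(\<Sum>u\<in>?U. \<chi> (?H u u)) = (- of_nat q) ^ m"
    by blast
  have image: "(\<lambda>u. fst u - g (fst u)) ` ?U = ?J"
    using sum_zero_image[OF g h] .
  have "{u \<in> ?U. \<forall>v\<in>?U. ?H u v = 0} = {(y, z). y - g y + (z - h z) = 0 \<and> g y - z \<in> perp ?J}"
  proof -
    have "(\<forall>v\<in>?U. ?H u v = 0) \<longleftrightarrow> g (fst u) - snd u \<in> perp ?J" for u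
    proof -
      have "(\<forall>v\<in>?U. ?H u v = 0) \<longleftrightarrow> (\<forall>w\<in>?J. F (g (fst u) - snd u) w = 0)"
        unfolding image[symmetric] by blast
      also have "\<dots> \<longleftrightarrow> g (fst u) - snd u \<in> perp ?J"
        unfolding perp_def using F_sym[of "g (fst u) - snd u"] by (simp only: \<eta>_eq_0_iff mem_Collect_eq)
      finally show ?thesis .
    qed
    then show ?thesis
      by (simp only: case_prod_unfold) blast
  qed
  then have "q ^ (2 * m) = card ?J * (card (fixed g) * card (fixed h)) * (card (perp ?J) * card (fixed (fcomp g h)))"
    using m(1) card_sum_zero[OF g h] card_radical[OF g h] by simp
  also have "\<dots> = CARD('v) * card (fixed g) * card (fixed h) * card (fixed (fcomp g h))"
    using card_perp[of ?J] g h by (simp add: subspace_inter subspace_image mult_ac)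
  also have "\<dots> = q ^ (2 * (dim (fixed g) + dim (fixed h) + dim (fixed (fcomp g h)) + dim (UNIV :: 'v set)))"
    using card_subspace_q[OF subspace_fixed[OF g]] card_subspace_q[OF subspace_fixed[OF h]]
      card_subspace_q[OF subspace_fixed[OF isometry_fcomp[OF g h]]] card_subspace_q[OF subspace_UNIV]
    by (simp add: power_add mult_ac distrib_left)
  finally have "m = dim (fixed g) + dim (fixed h) + dim (fixed (fcomp g h)) + dim (UNIV :: 'v set)"
    using q_gt_1 by (simp add: power_inject_exp)
  moreover have "cocycle_sum g h 0 = (\<Sum>u\<in>?U. \<chi> (?H u u))"
    unfolding cocycle_sum_def
  proof (rule sum.cong)
    fix u assume "u \<in> ?U"
    then obtain y z where u: "u = (y, z)" and "y - g y + (z - h z) = 0" by auto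
    then have 1: "z - h z = - (y - g y)"
      using add.commute[of "z - h z" "y - g y"] by (simp only: eq_neg_iff_add_eq_0)
    have "F y (y - g y) + F z (z - h z) + F (y - g y) (z - h z) = F (g y - z) (y - g y)"
      unfolding 1 by (simp add: algebra_simps)
    then show "(case u of (y, z) \<Rightarrow> \<chi> (F y (y - g y) + F z (z - h z) + F (y - g y) (z - h z))) = \<chi> (?H u u)"
      by (simp only: u prod.case fst_conv snd_conv)
  qed simp
  ultimately show ?thesis
    using m(2) by simp
qed

end

subsection \<open>The operators of the Weil representation\<close>

text \<open>A projective representation of V: \<open>P x\<close> stands for \<rho> (x, 0), with the
  central factor already evaluated as a scalar. In \<open>P_mult\<close> the factor
  \<open>P x\<close> is applied first because maps act on the right.\<close>

locale heisenberg_representation =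
  hermitian_space \<eta> \<chi> scale F + W: vector_space scale'
  for \<eta> :: "'k::{field,finite} \<Rightarrow> 'k" and \<chi> :: "'k \<Rightarrow> 'l::field"
    and scale :: "'k \<Rightarrow> 'v::ab_group_add \<Rightarrow> 'v" and F
    and scale' :: "'l \<Rightarrow> 'w::ab_group_add \<Rightarrow> 'w" +
  fixes P :: "'v \<Rightarrow> 'w \<Rightarrow> 'w"
  assumes P_linear: "Vector_Spaces.linear scale' scale' (P x)"
    and P_0: "P 0 w = w"
    and P_mult: "P y (P x w) = scale' (\<chi> (F x y)) (P (x + y) w)"
begin

lemma P_scale: "P x (scale' c w) = scale' c (P x w)"
  and P_sum: "P x (sum h A) = (\<Sum>a\<in>A. P x (h a))"
  and P_zero: "P x 0 = 0"
proof -
  interpret P: Vector_Spaces.linear scale' scale' "P x"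
    by (rule P_linear)
  show "P x (scale' c w) = scale' c (P x w)" "P x (sum h A) = (\<Sum>a\<in>A. P x (h a))" "P x 0 = 0"
    by (simp_all add: P.scale P.sum P.zero)
qed

text \<open>This is s(g): for an isometry, \<rho> (y, 0) \<rho> (g y, 0)^-1 has V-part y - g y, and
  its central part reduces to f y (y - g y) because f (g y) (g y) = f y y.\<close>

definition weil :: "('v \<Rightarrow> 'v) \<Rightarrow> 'w \<Rightarrow> 'w" where
  "weil g w = scale' (inverse (of_nat CARD('v)))
     (\<Sum>y\<in>UNIV. scale' (\<chi> (F y (y - g y))) (P (y - g y) w))"

lemma card_V_nonzero: "of_nat CARD('v) \<noteq> (0 :: 'l)"
  using q_nonzero by (simp add: card_subspace_q[OF subspace_UNIV])

lemma card_fixed_nonzero: "isometry g \<Longrightarrow> of_nat (card (fixed g)) \<noteq> (0 :: 'l)"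
  using q_nonzero by (simp add: card_subspace_q[OF subspace_fixed])

lemma weil_zero: "weil g 0 = 0"
  by (simp add: weil_def P_zero)

lemma weil_id: "weil id w = w"
  using card_V_nonzero by (simp add: weil_def P_0 W.sum_constant_scale)

lemma sum_image_one_minus:
  fixes h :: "'v \<Rightarrow> 'w"
  assumes k: "isometry k"
  shows "(\<Sum>t\<in>UNIV. h (t - k t)) = scale' (of_nat (card (fixed k))) (\<Sum>x\<in>image_one_minus k. h x)"
proof -
  have fibre: "card {t \<in> UNIV. t - k t = x} = card (fixed k)" if "x \<in> image_one_minus k" for x
  proof -
    obtain s where s: "x = s - k s"
      using \<open>x \<in> image_one_minus k\<close> by (auto simp: image_one_minus_def)
    have "bij_betw (\<lambda>t. t - s) {t \<in> UNIV. t - k t = x} (fixed k)"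
    proof (rule bij_betwI[where g = "\<lambda>t. t + s"])
      show "(\<lambda>t. t - s) \<in> {t \<in> UNIV. t - k t = x} \<rightarrow> fixed k"
      proof
        fix t assume "t \<in> {t \<in> UNIV. t - k t = x}"
        then have "t - k t - (s - k s) = 0"
          by (simp add: s)
        then have "(t - s) - k (t - s) = 0"
          by (simp add: isometry_linear[OF k] algebra_simps)
        then show "t - s \<in> fixed k"
          by (simp add: fixed_def)
      qed
    qed (auto simp: fixed_def s isometry_linear[OF k])
    then show ?thesis
      by (rule bij_betw_same_card)
  qed
  have "(\<Sum>t\<in>UNIV. h (t - k t))
      = (\<Sum>x\<in>range (\<lambda>t. t - k t). \<Sum>t | t \<in> UNIV \<and> t - k t = x. h (t - k t))"
    by (rule sum.image_gen) simp
  also have "\<dots> = (\<Sum>x\<in>image_one_minus k. scale' (of_nat (card (fixed k))) (h x))"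
  proof (rule sum.cong)
    fix x assume "x \<in> image_one_minus k"
    have "(\<Sum>t | t \<in> UNIV \<and> t - k t = x. h (t - k t)) = (\<Sum>t | t \<in> UNIV \<and> t - k t = x. h x)"
      by (rule sum.cong) auto
    then show "(\<Sum>t | t \<in> UNIV \<and> t - k t = x. h (t - k t)) = scale' (of_nat (card (fixed k))) (h x)"
      by (simp only: W.sum_constant_scale fibre[OF \<open>x \<in> _\<close>])
  qed (simp add: image_one_minus_def)
  finally show ?thesis
    by (simp add: W.scale_sum_right)
qed

text \<open>The constant compares two normalizations: the product carries |V|^-2 and sums each x
  once, while \<open>weil\<close> of the composite carries |V|^-1 and reaches each x from |fixed (g
  h)| vectors t.\<close>

lemma weil_mult:
  assumes g: "isometry g" and h: "isometry h"
  shows "weil h (weil g w)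
    = scale' (cocycle_sum g h 0 / (of_nat CARD('v) * of_nat (card (fixed (fcomp g h))))) (weil (fcomp g h) w)"
proof -
  let ?N = "of_nat CARD('v) :: 'l" and ?k = "fcomp g h"
  let ?e = "\<lambda>y z. F y (y - g y) + F z (z - h z) + F (y - g y) (z - h z)"
  let ?S = "\<Sum>x\<in>image_one_minus ?k. scale' (cocycle_sum g h x) (P x w)"
  have k: "isometry ?k"
    using g h by (rule isometry_fcomp)
  have "weil h (weil g w) = scale' (inverse ?N * inverse ?N)
      (\<Sum>z\<in>UNIV. \<Sum>y\<in>UNIV. scale' (\<chi> (?e y z)) (P (y - g y + (z - h z)) w))"
    by (simp add: weil_def P_scale P_sum P_mult W.scale_sum_right \<chi>_add mult_ac)
  also have "(\<Sum>z\<in>UNIV. \<Sum>y\<in>UNIV. scale' (\<chi> (?e y z)) (P (y - g y + (z - h z)) w))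
      = (\<Sum>(y, z)\<in>UNIV. scale' (\<chi> (?e y z)) (P (y - g y + (z - h z)) w))"
    by (subst sum.swap) (simp add: sum.cartesian_product)
  also have "\<dots> = (\<Sum>x\<in>UNIV. \<Sum>(y, z) | (y, z) \<in> UNIV \<and> y - g y + (z - h z) = x.
      scale' (\<chi> (?e y z)) (P (y - g y + (z - h z)) w))"
    using sum.group[of "UNIV :: ('v \<times> 'v) set" "UNIV :: 'v set" "\<lambda>(y, z). y - g y + (z - h z)"
        "\<lambda>(y, z). scale' (\<chi> (?e y z)) (P (y - g y + (z - h z)) w)"]
    by (simp add: finite_prod case_prod_unfold)
  also have "\<dots> = (\<Sum>x\<in>UNIV. scale' (cocycle_sum g h x) (P x w))"
  proof (rule sum.cong)
    fix x :: 'v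
    have "(\<Sum>(y, z) | (y, z) \<in> UNIV \<and> y - g y + (z - h z) = x. scale' (\<chi> (?e y z)) (P (y - g y + (z - h z)) w))
        = (\<Sum>(y, z) | y - g y + (z - h z) = x. scale' (\<chi> (?e y z)) (P x w))"
      by (rule sum.cong) auto
    then show "(\<Sum>(y, z) | (y, z) \<in> UNIV \<and> y - g y + (z - h z) = x.
        scale' (\<chi> (?e y z)) (P (y - g y + (z - h z)) w)) = scale' (cocycle_sum g h x) (P x w)"
      by (simp add: cocycle_sum_def W.scale_sum_left case_prod_unfold)
  qed simp
  also have "\<dots> = ?S"
    by (rule sum.mono_neutral_right) (auto simp: cocycle_sum_eq_0[OF g h])
  finally have 1: "weil h (weil g w) = scale' (inverse ?N * inverse ?N) ?S" .
  have "scale' (cocycle_sum g h 0) (weil ?k w)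
      = scale' (inverse ?N) (\<Sum>t\<in>UNIV. scale' (cocycle_sum g h (t - ?k t)) (P (t - ?k t) w))"
    by (simp add: weil_def W.scale_sum_right cocycle_sum_image[OF g h] mult_ac fcomp_apply)
  also have "\<dots> = scale' (inverse ?N * of_nat (card (fixed ?k))) ?S"
    by (simp only: sum_image_one_minus[OF k, of "\<lambda>x. scale' (cocycle_sum g h x) (P x w)"] W.scale_scale)
  finally have 2: "scale' (cocycle_sum g h 0) (weil ?k w) = scale' (inverse ?N * of_nat (card (fixed ?k))) ?S" .
  have "scale' (cocycle_sum g h 0 / (?N * of_nat (card (fixed ?k)))) (weil ?k w)
      = scale' (inverse (?N * of_nat (card (fixed ?k)))) (scale' (cocycle_sum g h 0) (weil ?k w))"
    by (simp add: field_simps)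
  also have "\<dots> = scale' (inverse ?N * inverse ?N) ?S"
    unfolding 2 using card_V_nonzero card_fixed_nonzero[OF k] by (simp add: field_simps)
  finally show ?thesis
    using 1 by simp
qed

lemma weil_factor:
  assumes g: "isometry g" and h: "isometry h"
    and \<mu>: "\<And>g. \<mu> g = (- of_nat q) powi (- int (dim (image_one_minus g)))"
  shows "cocycle_sum g h 0 / (of_nat CARD('v) * of_nat (card (fixed (fcomp g h))))
    = \<mu> g * \<mu> h * inverse (\<mu> (fcomp g h))"
proof -
  define a :: 'l where "a = - of_nat q"
  have a: "a \<noteq> 0"
    using q_nonzero by (simp add: a_def)
  have k: "isometry (fcomp g h)"
    using g h by (rule isometry_fcomp)
  \<comment> \<open>Cardinalities of subspaces are even powers of q, hence equally powers of - q;
    the claim thereby becomes an identity between exponents of one base.\<close>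
  have card: "of_nat (card M) = a ^ (2 * dim M)" if "subspace M" for M
    by (simp add: card_subspace_q[OF that] a_def power_mult)
  have rank: "dim (UNIV :: 'v set) = dim (image_one_minus g) + dim (fixed g)" if "isometry g" for g
  proof -
    have "q ^ (2 * dim (UNIV :: 'v set)) = q ^ (2 * (dim (image_one_minus g) + dim (fixed g)))"
      using card_image_fixed[OF that] card_subspace_q[OF subspace_image[OF that]]
        card_subspace_q[OF subspace_fixed[OF that]] card_subspace_q[OF subspace_UNIV]
      by (simp add: power_add distrib_left)
    then show ?thesis
      using q_gt_1 by (simp add: power_inject_exp)
  qed
  have \<mu>': "\<mu> g = inverse (a ^ dim (image_one_minus g))" for g
    by (simp add: \<mu> a_def power_int_minus)
  let ?d = "\<lambda>g. dim (fixed g)" and ?i = "\<lambda>g. dim (image_one_minus g)" and ?N = "dim (UNIV :: 'v set)"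
  have "?d g + ?d h + ?d (fcomp g h) + ?N + ?i g + ?i h = 2 * ?N + 2 * ?d (fcomp g h) + ?i (fcomp g h)"
    using rank[OF g] rank[OF h] rank[OF k] by linarith
  then have "a ^ (?d g + ?d h + ?d (fcomp g h) + ?N) * a ^ ?i g * a ^ ?i h
      = a ^ (2 * ?N) * a ^ (2 * ?d (fcomp g h)) * a ^ ?i (fcomp g h)"
    unfolding power_add[symmetric] by (rule arg_cong[where f = "\<lambda>n. a ^ n"])
  then show ?thesis
    unfolding \<mu>' cocycle_sum_0[OF g h] a_def[symmetric] card[OF subspace_UNIV] card[OF subspace_fixed[OF k]]
    using a by (simp add: field_simps)
qed

text \<open>Composing with the operator of the inverse isometry gives a nonzero multiple of the
  identity. Some nonzero value is needed to make the scalar in \<open>factor_set\<close>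
  unique.\<close>

lemma weil_nonzero:
  assumes g: "isometry g" and "w \<noteq> 0"
  shows "weil g w \<noteq> 0"
proof
  assume "weil g w = 0"
  have bij: "bij g"
    using g by (simp add: isometry_def)
  have h: "isometry (inv_into UNIV g)"
    using g by (rule isometry_inv)
  have id: "fcomp g (inv_into UNIV g) = id"
    using bij by (simp add: fcomp_comp fun_eq_iff bij_is_inj)
  have "isometry id"
    using isometry_fcomp[OF g h] id by simp
  have "cocycle_sum g (inv_into UNIV g) 0 \<noteq> 0"
    using q_nonzero by (simp add: cocycle_sum_0[OF g h])
  moreover have "scale' (cocycle_sum g (inv_into UNIV g) 0 / (of_nat CARD('v) * of_nat (card (fixed id)))) w = 0"
    using weil_mult[OF g h, of w] \<open>weil g w = 0\<close> by (simp add: id weil_zero weil_id)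
  ultimately show False
    using \<open>w \<noteq> 0\<close> card_V_nonzero card_fixed_nonzero[OF \<open>isometry id\<close>] by simp
qed

end

text \<open>With S the line of skew elements, K = S + lam S because lam is not fixed by
  \<open>\<eta>\<close>. An \<open>\<eta>\<close>-invariant \<open>T\<close> already vanishes on S;
  if it vanished on lam S too, it would be zero.\<close>

lemma (in field_involution) trace_skew:
  fixes T :: "'k \<Rightarrow> 'z::ab_group_add"
  assumes add: "\<And>x y. T (x + y) = T x + T y" and inv: "\<And>x. T (\<eta> x) = T x" and nz: "T x0 \<noteq> 0"
    and lam: "lam \<noteq> \<eta> lam" and c: "c \<noteq> 0" "\<eta> c = - c"
  shows "\<exists>t. \<eta> t = t \<and> T (lam * (c * t)) \<noteq> 0"
proof (rule ccontr)
  assume "\<not> ?thesis"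
  then have 1: "T (lam * (c * t)) = 0" if "\<eta> t = t" for t
    using that by blast
  have diff: "T (x - y) = T x - T y" for x y
    using add[of "x - y" y] by simp
  \<comment> \<open>An element of nonzero relative trace: 1 if the characteristic is odd, otherwise
    any element moved by \<open>\<eta>\<close>.\<close>
  obtain v where v: "v + \<eta> v \<noteq> 0"
  proof (cases "(1 :: 'k) + 1 = 0")
    case True
    obtain u where "\<eta> u \<noteq> u"
      using nontrivial_ex by blast
    moreover have "- u = u"
      using True by (metis add_eq_0_iff distrib_right mult_1 mult_zero_left)
    ultimately have "u + \<eta> u \<noteq> 0"
      by (metis add_eq_0_iff2 add.commute)
    then show ?thesis by (rule that)
  next
    case False
    then show ?thesis
      by (intro that[of 1]) simp
  qed
  text \<open>Additive Hilbert 90: \<open>s\<close> is of the form \<open>z - \<eta> z\<close>.\<close>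
  have 2: "T s = 0" if s: "\<eta> s = - s" for s
  proof -
    define z where "z = s * v / (v + \<eta> v)"
    have "z - \<eta> z = s * v / (v + \<eta> v) + s * \<eta> v / (v + \<eta> v)"
      by (simp add: z_def s add.commute)
    also have "\<dots> = s"
      using v by (simp add: divide_eq_eq distrib_left flip: add_divide_distrib)
    finally show ?thesis
      using diff[of z "\<eta> z"] by (simp add: inv)
  qed
  \<comment> \<open>Write x0 / c as a + b lam with a and b in the fixed field. Then x0 = c a + lam
    (c b), where the first summand is skew.\<close>
  define y where "y = x0 / c"
  define b where "b = (y - \<eta> y) / (lam - \<eta> lam)"
  have b: "\<eta> b = b"
    using minus_divide_divide[of "y - \<eta> y" "lam - \<eta> lam"] by (simp add: b_def)
  have "b * (lam - \<eta> lam) = y - \<eta> y"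
    using lam by (simp add: b_def)
  then have "\<eta> (y - b * lam) = y - b * lam"
    by (simp add: b algebra_simps)
  then have "\<eta> (c * (y - b * lam)) = - (c * (y - b * lam))"
    using c(2) by (simp del: \<eta>_diff)
  moreover have "x0 = c * (y - b * lam) + lam * (c * b)"
    using c(1) by (simp add: y_def algebra_simps)
  ultimately have "T x0 = 0"
    using 1[OF b] 2 by (metis add add.left_neutral)
  with nz show False ..
qed

section \<open>Inverses in the general linear group and the isometry group\<close>

lemma group_general_linear:
  assumes "vector_space scale"
  shows "group (general_linear scale)"
proof (rule groupI)
  interpret vector_space scale by fact
  show "\<one>\<^bsub>general_linear scale\<^esub> \<in> carrier (general_linear scale)"
    by (simp add: general_linear_def Vector_Spaces.linear_iff assms)
  show "g \<otimes>\<^bsub>general_linear scale\<^esub> h \<in> carrier (general_linear scale)"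
    if "g \<in> carrier (general_linear scale)" "h \<in> carrier (general_linear scale)" for g h
    using that by (auto simp: general_linear_def fcomp_comp bij_comp intro: Vector_Spaces.linear_compose)
  fix g assume g: "g \<in> carrier (general_linear scale)"
  then interpret g: Vector_Spaces.linear scale scale g
    by (simp add: general_linear_def)
  have bij: "bij g"
    using g by (simp add: general_linear_def)
  then have inv: "g (inv_into UNIV g x) = x" "inv_into UNIV g (g x) = x" for x
    by (simp_all add: bij_is_surj bij_is_inj surj_f_inv_f)
  have "inv_into UNIV g (x + y) = inv_into UNIV g x + inv_into UNIV g y"
    "inv_into UNIV g (scale c x) = scale c (inv_into UNIV g x)" for x y c
    using g.add g.scale inv by metis+
  then have "Vector_Spaces.linear scale scale (inv_into UNIV g)"
    by (simp add: Vector_Spaces.linear_iff assms)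
  then show "\<exists>h\<in>carrier (general_linear scale). h \<otimes>\<^bsub>general_linear scale\<^esub> g = \<one>\<^bsub>general_linear scale\<^esub>"
    using bij by (intro bexI[of _ "inv_into UNIV g"])
      (simp_all add: general_linear_def bij_imp_bij_inv fcomp_def fun_eq_iff inv)
qed (simp_all add: general_linear_def fcomp_def fun_eq_iff)

lemma inv_general_linear:
  assumes "vector_space scale" and g: "g \<in> carrier (general_linear scale)"
  shows "inv\<^bsub>general_linear scale\<^esub> g = inv_into UNIV g"
proof -
  interpret group "general_linear scale"
    by (rule group_general_linear) fact
  have "fcomp (m_inv (general_linear scale) g) g = id"
    using l_inv[OF g] by (simp add: general_linear_def)
  then have "g (m_inv (general_linear scale) g x) = x" for x
    by (simp add: fun_eq_iff fcomp_apply)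
  moreover have "inj g"
    using g by (simp add: general_linear_def bij_is_inj)
  ultimately show ?thesis
    by (metis inv_f_eq ext)
qed

lemma inv_isometry_group:
  assumes "vector_space scale" and g: "g \<in> carrier (isometry_group scale f)"
  shows "inv\<^bsub>isometry_group scale f\<^esub> g = inv_into UNIV g"
proof -
  interpret group "general_linear scale"
    by (rule group_general_linear) fact
  have GL: "g \<in> carrier (general_linear scale)" if "g \<in> carrier (isometry_group scale f)" for g
    using that by (simp add: isometry_group_def)
  have "subgroup (carrier (isometry_group scale f)) (general_linear scale)"
  proof (rule subgroupI)
    show "carrier (isometry_group scale f) \<noteq> {}"
      using g by blast
    show "h \<otimes>\<^bsub>general_linear scale\<^esub> k \<in> carrier (isometry_group scale f)"
      if "h \<in> carrier (isometry_group scale f)" "k \<in> carrier (isometry_group scale f)" for h k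
      using that m_closed[of h k] by (simp add: isometry_group_def) (simp add: general_linear_def fcomp_apply)
    fix h assume h: "h \<in> carrier (isometry_group scale f)"
    then have "bij h" and f: "f (h x) (h y) = f x y" for x y
      by (auto simp: isometry_group_def general_linear_def)
    then have "f (inv_into UNIV h x) (inv_into UNIV h y) = f x y" for x y
      by (metis bij_is_surj surj_f_inv_f)
    then show "inv\<^bsub>general_linear scale\<^esub> h \<in> carrier (isometry_group scale f)"
      using inv_closed[OF GL[OF h]] inv_general_linear[OF assms(1) GL[OF h]]
      by (simp add: isometry_group_def)
  qed (auto intro: GL)
  then have "inv\<^bsub>general_linear scale \<lparr>carrier := carrier (isometry_group scale f)\<rparr>\<^esub> g = inv\<^bsub>general_linear scale\<^esub> g"
    by (rule m_inv_consistent) (rule g)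
  moreover have "general_linear scale \<lparr>carrier := carrier (isometry_group scale f)\<rparr> = isometry_group scale f"
    by (simp add: isometry_group_def)
  ultimately show ?thesis
    using inv_general_linear[OF assms(1) GL[OF g]] by simp
qed

text \<open>A nonzero t generates the group of prime order, so a character trivial at t is trivial.
  Nonzero traces thereby give character values different from 1.\<close>

lemma additive_character_eq_1:
  fixes \<theta> :: "'p::prime_card mod_ring \<Rightarrow> 'l::field"
  assumes add: "\<And>s t. \<theta> (s + t) = \<theta> s * \<theta> t" and 0: "\<theta> 0 = 1" and nontrivial: "\<theta> u \<noteq> 1"
    and t: "\<theta> t = 1"
  shows "t = 0"
proof (rule ccontr)
  assume "t \<noteq> 0"
  obtain n where n: "u / t = of_nat n"
    using surj_of_nat_mod_ring by blast
  have power: "\<theta> (of_nat m * t) = \<theta> t ^ m" for m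
    by (induction m) (simp_all add: 0 add distrib_right)
  have "u = of_nat n * t"
    using \<open>t \<noteq> 0\<close> n by (simp add: divide_eq_eq)
  then show False
    using power[of n] nontrivial t by simp
qed

text \<open>In characteristic p there are no nontrivial p-th roots of unity, as (z - 1)^p = z^p - 1.
  This makes q and |V| invertible in the representation field.\<close>

lemma additive_character_char:
  fixes \<theta> :: "'p::prime_card mod_ring \<Rightarrow> 'l::field"
  assumes add: "\<And>s t. \<theta> (s + t) = \<theta> s * \<theta> t" and 0: "\<theta> 0 = 1" and nontrivial: "\<theta> u \<noteq> 1"
  shows "of_nat CARD('p) \<noteq> (0 :: 'l)"
proof
  assume "of_nat CARD('p) = (0 :: 'l)"
  then have "CHAR('l) dvd CARD('p)"
    by (simp only: of_nat_eq_0_iff_char_dvd)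
  then have char: "CHAR('l) = CARD('p)"
    using prime_card[where ?'a = 'p] by (metis CHAR_not_1' One_nat_def prime_nat_iff)
  have power: "\<theta> (of_nat m * u) = \<theta> u ^ m" for m
    by (induction m) (simp_all add: 0 add distrib_right)
  have "(\<theta> u - 1 + 1) ^ CARD('p) = (\<theta> u - 1) ^ CARD('p) + 1 ^ CARD('p)"
    by (rule freshmans_dream) (simp_all add: char prime_card)
  then have "(\<theta> u - 1) ^ CARD('p) = 0"
    using power[of "CARD('p)"] 0 by simp
  then show False
    using nontrivial by simp
qed

lemma field_automorphism_of_nat_powi:
  assumes "field_automorphism h"
  shows "h ((- of_nat n) powi (- int m)) = (- of_nat n) powi (- int m)"
proof -
  have add: "h (x + y) = h x + h y" and mult: "h (x * y) = h x * h y" and 1: "h 1 = 1" for x y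
    using assms by (auto simp: field_automorphism_def)
  have 0: "h 0 = 0"
    using add[of 0 0] by (metis add.right_neutral add_cancel_right_right)
  have nat: "h (of_nat k) = of_nat k" for k
    by (induction k) (simp_all add: 0 1 add)
  have minus: "h (- x) = - h x" for x
    using add[of x "- x"] by (simp add: 0 eq_neg_iff_add_eq_0 add.commute)
  have power: "h (x ^ k) = h x ^ k" for x k
    by (induction k) (simp_all add: 1 mult)
  have inverse: "h (inverse x) = inverse (h x)" for x
  proof (cases "x = 0")
    case False
    then show ?thesis
      using mult[of x "inverse x"] by (metis 1 inverse_unique right_inverse)
  qed (simp add: 0)
  show ?thesis
    by (simp add: power_int_minus inverse power minus nat)
qed

theorem theorem6p3:
  fixes scale :: "'k::{field,finite} \<Rightarrow> 'v::ab_group_add \<Rightarrow> 'v"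
    and scale' :: "'l::field \<Rightarrow> 'w::ab_group_add \<Rightarrow> 'w"
    and F :: "'v \<Rightarrow> 'v \<Rightarrow> 'k"
    and f :: "'v \<Rightarrow> 'v \<Rightarrow> 'p::prime_card mod_ring"
    and \<rho> :: "'v \<times> 'p mod_ring \<Rightarrow> 'w \<Rightarrow> 'w"
    and \<mu> :: "('v \<Rightarrow> 'v) \<Rightarrow> 'l"
    and i :: "('v \<Rightarrow> 'v) \<Rightarrow> nat"
    and p q n :: nat
  assumes p: "p = CARD('p)" "CHAR('k) = p"
    and eta: "field_automorphism \<eta>" "\<eta> \<circ> \<eta> = id" "\<eta> \<noteq> id"
    and q: "q = card {x. \<eta> x = x}"
    and V: "finite_dimensional_vector_space scale Basis" "\<exists>v::'v. v \<noteq> 0"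
    and dim_V: "vector_space.dim (\<lambda>a::'p mod_ring. scale (prime_field_emb a)) UNIV = 2 * n"
    and F: "hermitian_form scale \<eta> F" "nondegenerate_form F"
    and lam: "lam \<noteq> \<eta> lam"
    and f: "\<And>u v. f u v = abs_trace (lam * F u v)"
    and V': "vector_space scale'" "vector_space.dim scale' UNIV = p ^ n"
    and rho: "\<rho> \<in> hom (extraspecial_group f) (general_linear scale')"
             "absolutely_irreducible scale' (extraspecial_group f) \<rho>"
    and i: "\<And>g. i g = vector_space.dim scale (image_one_minus g)"
    and mu: "\<And>g. \<mu> g = (- of_nat q) powi (- int (i g))"
  shows "(\<forall>g \<in> carrier (isometry_group scale f). \<forall>h \<in> carrier (isometry_group scale f).
            factor_set scale' \<rho> g h = \<mu> g * \<mu> h * inverse (\<mu> (g \<otimes>\<^bsub>isometry_group scale f\<^esub> h)))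
       \<and> (\<forall>\<eta>'. field_automorphism \<eta>' \<and>
            \<eta>' (central_scalar scale' \<rho>) = inverse (central_scalar scale' \<rho>) \<longrightarrow>
            (\<forall>g \<in> carrier (isometry_group scale f).
               \<mu> g = \<eta>' (\<mu> (inv\<^bsub>isometry_group scale f\<^esub> g))))"
proof -
  have card_p: "CHAR('k) = CARD('p)"
    using p by simp
  interpret V: finite_dimensional_vector_space scale Basis by (rule V(1))
  interpret W: vector_space scale' by (rule V'(1))
  interpret field_involution \<eta>
    by unfold_locales (use eta in \<open>auto simp: fun_eq_iff\<close>)
  have finite_V: "finite (UNIV :: 'v set)"
    using V.finite_span[OF V.finite_Basis] by (simp add: V.span_Basis)
  have hermitian: "F (x + y) z = F x z + F y z" "F (scale c x) z = c * F x z"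
    "F x (y + z) = F x y + F x z" for x y z c
    using F(1) unfolding hermitian_form_def Vector_Spaces.linear_iff by blast+
  note trace_add = abs_trace_add[OF card_p]
  have trace_0: "abs_trace (0 :: 'k) = (0 :: 'p mod_ring)"
    using trace_add[of 0 0] by (metis add.right_neutral add_cancel_right_right)
  have f_add: "f (x + y) z = f x z + f y z" "f x (y + z) = f x y + f x z" for x y z
    by (simp_all add: f hermitian distrib_left trace_add)
  have f_0: "f 0 x = 0" "f x 0 = 0" for x
    using f_add(1)[of 0 0 x] f_add(2)[of x 0 0] by (metis add.right_neutral add_cancel_right_right)+
  have f_minus: "f (- x) y = - f x y" "f x (- y) = - f x y" for x y
    using f_add(1)[of x "- x" y] f_add(2)[of x y "- y"] by (simp_all add: f_0 eq_neg_iff_add_eq_0 add.commute)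
  \<comment> \<open>A nonzero V forces n > 0, so the degree p^n exceeds 1, as the nontriviality of
    the central character requires.\<close>
  have dim: "W.dim UNIV > 1"
  proof -
    interpret Fp: vector_space "\<lambda>a::'p mod_ring. scale (prime_field_emb a)"
      by (rule vector_space_prime_field[OF card_p]) unfold_locales
    have "CARD('v) = CARD('p) ^ (2 * n)"
      using Fp.card_subspace[OF Fp.subspace_UNIV finite_V] by (simp add: dim_V)
    moreover have "CARD('v) \<noteq> 1"
      using V(2) by (metis UNIV_I card_1_singletonE singletonD)
    ultimately have "n > 0"
      by (cases n) simp_all
    then have "CARD('p) ^ n > 1"
      by (intro one_less_power prime_gt_1_nat prime_card)
    then show ?thesis
      by (simp only: V'(2) p(1))
  qed
  have finite_E: "finite (UNIV :: ('v \<times> 'p mod_ring) set)"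
    using finite_V by (simp add: finite_prod)
  obtain \<theta> where \<theta>: "\<And>t. \<rho> (0, t) = scale' (\<theta> t)"
    and \<theta>_add: "\<And>s t. \<theta> (s + t) = \<theta> s * \<theta> t"
    and \<theta>_0: "\<theta> 0 = 1" and \<theta>_nontrivial: "\<exists>t. \<theta> t \<noteq> 1"
    by (rule extraspecial_central_character[OF f_0 finite_E rho dim]) (rule that)
  obtain u where u: "\<theta> u \<noteq> 1"
    using \<theta>_nontrivial by blast
  \<comment> \<open>Absorbing lam and the trace into the character turns \<theta> (f x y) into a
    value at the Hermitian form \<open>F\<close>.\<close>
  define \<chi> where "\<chi> x = \<theta> (abs_trace (lam * x))" for x
  have \<chi>_f: "\<chi> (F x y) = \<theta> (f x y)" for x y
    by (simp add: \<chi>_def f)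
  have q_nonzero: "of_nat (card {x. \<eta> x = x}) \<noteq> (0 :: 'l)"
  proof
    assume "of_nat (card {x. \<eta> x = x}) = (0 :: 'l)"
    then have "of_nat CARD('k) = (0 :: 'l)"
      by (simp add: card_field)
    moreover obtain d where "CARD('k) = CARD('p) ^ d"
      using card_prime_power[OF card_p] by blast
    ultimately have "of_nat CARD('p) = (0 :: 'l)"
      by simp
    then show False
      using additive_character_char[OF \<theta>_add \<theta>_0 u] by blast
  qed
  obtain x0 where x0: "abs_trace (x0 :: 'k) \<noteq> (0 :: 'p mod_ring)"
    using abs_trace_nonzero[OF card_p] by blast
  interpret hermitian_space \<eta> \<chi> scale F
  proof unfold_locales
    show "\<chi> (x + y) = \<chi> x * \<chi> y" for x y
      by (simp add: \<chi>_def distrib_left trace_add \<theta>_add)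
    show "\<chi> 0 = 1"
      by (simp add: \<chi>_def trace_0 \<theta>_0)
    show "\<exists>t. \<eta> t = t \<and> \<chi> (c * t) \<noteq> 1" if "c \<noteq> 0" "\<eta> c = - c" for c
      using trace_skew[OF trace_add abs_trace_automorphism[OF card_p eta(1)] x0 lam that]
        additive_character_eq_1[OF \<theta>_add \<theta>_0 u] unfolding \<chi>_def by blast
  qed (fact finite_V F q_nonzero)+
  have \<rho>_linear: "Vector_Spaces.linear scale' scale' (\<rho> x)"
    and \<rho>_GL: "\<rho> x \<in> carrier (general_linear scale')" for x
    using hom_in_carrier[OF rho(1), of x] by (simp_all add: extraspecial_group_def general_linear_def)
  have \<rho>_mult: "\<rho> (y, t) (\<rho> (x, s) w) = \<rho> (x + y, s + t + f x y) w" for x y s t w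
    using fun_cong[OF hom_mult[OF rho(1), of "(x, s)" "(y, t)"], of w]
    by (simp add: extraspecial_group_def general_linear_def fcomp_apply)
  have \<rho>_central: "\<rho> (x, t) w = scale' (\<theta> t) (\<rho> (x, 0) w)" for x t w
    using \<rho>_mult[of 0 t x 0 w] by (simp add: \<theta> f_0)
  have \<rho>_0: "\<rho> (0, 0) w = w" for w
    by (simp add: \<theta> \<theta>_0)
  interpret heisenberg_representation \<eta> \<chi> scale F scale' "\<lambda>x. \<rho> (x, 0)"
  proof (intro heisenberg_representation.intro heisenberg_representation_axioms.intro)
    show "\<rho> (y, 0) (\<rho> (x, 0) w) = scale' (\<chi> (F x y)) (\<rho> (x + y, 0) w)" for x y w
      unfolding \<rho>_mult \<chi>_f by (subst \<rho>_central) simp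
  qed (fact hermitian_space_axioms V'(1) \<rho>_linear \<rho>_0)+
  interpret GL: group "general_linear scale'"
    by (rule group_general_linear) (rule V'(1))
  \<comment> \<open>In the extraspecial group (- x, f x x) is inverse to (x, 0), since f (- x) x = -
    f x x.\<close>
  have \<rho>_inv: "inv\<^bsub>general_linear scale'\<^esub> (\<rho> (x, 0)) = \<rho> (- x, f x x)" for x
  proof (rule GL.inv_equality)
    show "\<rho> (- x, f x x) \<otimes>\<^bsub>general_linear scale'\<^esub> \<rho> (x, 0) = \<one>\<^bsub>general_linear scale'\<^esub>"
      by (simp add: general_linear_def fun_eq_iff fcomp_apply \<rho>_mult f_minus \<rho>_0)
  qed (rule \<rho>_GL)+
  have isometry: "isometry g" if g: "g \<in> carrier (isometry_group scale f)" for g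
  proof -
    have lin: "Vector_Spaces.linear scale scale g" and "bij g" and f_g: "f (g x) (g y) = f x y" for x y
      using g by (auto simp: isometry_group_def general_linear_def)
    interpret g: Vector_Spaces.linear scale scale g by (rule lin)
    have "F (g x) (g y) = F x y" for x y
    proof (rule ccontr)
      assume neq: "F (g x) (g y) \<noteq> F x y"
      \<comment> \<open>Scaling x by \<open>c\<close> makes the discrepancy in
        \<open>lam * F\<close> equal to \<open>x0\<close>, whose trace is nonzero, although
        \<open>f\<close> is preserved.\<close>
      define c where "c = x0 / (lam * (F (g x) (g y) - F x y))"
      have "lam \<noteq> 0"
        using lam by auto
      then have x0_eq: "lam * F (g (scale c x)) (g y) = lam * F (scale c x) y + x0"
        using neq by (simp add: c_def g.scale hermitian field_simps)
      have "abs_trace (lam * F (scale c x) y) = abs_trace (lam * F (scale c x) y) + (abs_trace x0 :: 'p mod_ring)"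
        using f_g[of "scale c x" y] by (simp only: f x0_eq trace_add)
      with x0 show False by simp
    qed
    then show ?thesis
      using lin \<open>bij g\<close> by (simp add: isometry_def)
  qed
  have weil_op: "weil_op scale' \<rho> g = weil g" if g: "g \<in> carrier (isometry_group scale f)" for g
  proof
    fix w
    have "(\<rho> (y, 0) \<otimes>\<^bsub>general_linear scale'\<^esub> inv\<^bsub>general_linear scale'\<^esub> (\<rho> (g y, 0))) w
        = scale' (\<chi> (F y (y - g y))) (\<rho> (y - g y, 0) w)" for y
    proof -
      have "f (g y) (g y) = f y y"
        using g by (simp add: isometry_group_def)
      then have exponent: "f (g y) (g y) + 0 + f y (- g y) = f y (y - g y)"
        using f_add(2)[of y y "- g y"] by simp
      have "(\<rho> (y, 0) \<otimes>\<^bsub>general_linear scale'\<^esub> inv\<^bsub>general_linear scale'\<^esub> (\<rho> (g y, 0))) w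
          = \<rho> (- g y, f (g y) (g y)) (\<rho> (y, 0) w)"
        unfolding \<rho>_inv by (simp add: general_linear_def fcomp_apply)
      also have "\<dots> = \<rho> (y - g y, f y (y - g y)) w"
        unfolding \<rho>_mult using exponent by (simp add: add.commute)
      finally show ?thesis
        by (simp only: \<rho>_central[of "y - g y" "f y (y - g y)"] \<chi>_f)
    qed
    then show "weil_op scale' \<rho> g w = weil g w"
      by (simp only: weil_op_def weil_def)
  qed
  obtain w0 :: 'w where w0: "w0 \<noteq> 0"
  proof (rule ccontr)
    assume "\<not> thesis"
    then have "(UNIV :: 'w set) \<subseteq> W.span {}"
      using that by auto
    then have "W.dim UNIV \<le> card ({} :: 'w set)"
      by (rule W.dim_le_card) simp
    with dim show False by simp
  qed
  have \<mu>: "\<mu> g = (- of_nat (card {x. \<eta> x = x})) powi (- int (V.dim (image_one_minus g)))" for g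
    by (simp add: mu i q)
  have closed: "fcomp g h \<in> carrier (isometry_group scale f)"
    if "g \<in> carrier (isometry_group scale f)" "h \<in> carrier (isometry_group scale f)" for g h
    using that by (auto simp: isometry_group_def general_linear_def fcomp_comp bij_comp
        intro: Vector_Spaces.linear_compose)
  show ?thesis
  proof (intro conjI ballI allI impI)
    fix g h
    assume g: "g \<in> carrier (isometry_group scale f)" and h: "h \<in> carrier (isometry_group scale f)"
    let ?c = "\<mu> g * \<mu> h * inverse (\<mu> (fcomp g h))"
    have mult: "weil h (weil g w) = scale' ?c (weil (fcomp g h) w)" for w
      using weil_mult[OF isometry[OF g] isometry[OF h], of w]
      unfolding weil_factor[OF isometry[OF g] isometry[OF h] \<mu>] .
    have nz: "weil (fcomp g h) w0 \<noteq> 0"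
      by (rule weil_nonzero[OF isometry[OF closed[OF g h]] w0])
    have "factor_set scale' \<rho> g h = ?c"
      unfolding factor_set_def weil_op[OF g] weil_op[OF h] weil_op[OF closed[OF g h]]
    proof (rule the_equality)
      show "?c \<noteq> 0 \<and> fcomp (weil g) (weil h) = (\<lambda>w. scale' ?c (weil (fcomp g h) w))"
        using q_nonzero by (simp add: fun_eq_iff fcomp_apply mult mu q)
      fix c assume "c \<noteq> 0 \<and> fcomp (weil g) (weil h) = (\<lambda>w. scale' c (weil (fcomp g h) w))"
      then have "scale' ?c (weil (fcomp g h) w0) = scale' c (weil (fcomp g h) w0)"
        using mult[of w0] by (metis fcomp_apply)
      then show "c = ?c"
        using nz by (simp only: W.scale_cancel_right) simp
    qed
    then show "factor_set scale' \<rho> g h = \<mu> g * \<mu> h * inverse (\<mu> (g \<otimes>\<^bsub>isometry_group scale f\<^esub> h))"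
      by (simp add: isometry_group_def general_linear_def)
  next
    fix \<eta>' g
    assume \<eta>': "field_automorphism \<eta>' \<and> \<eta>' (central_scalar scale' \<rho>) = inverse (central_scalar scale' \<rho>)"
      and g: "g \<in> carrier (isometry_group scale f)"
    have "bij g"
      using isometry[OF g] by (simp add: isometry_def)
    then have inv: "g (inv_into UNIV g x) = x" "inv_into UNIV g (g x) = x" for x
      by (simp_all add: bij_is_surj bij_is_inj surj_f_inv_f)
    have lin: "g (- x) = - g x" for x
      by (rule isometry_linear[OF isometry[OF g]])
    have "image_one_minus (inv_into UNIV g) = image_one_minus g"
    proof (intro subset_antisym subsetI)
      fix u assume "u \<in> image_one_minus (inv_into UNIV g)"
      then obtain x where "u = x - inv_into UNIV g x"
        by (auto simp: image_one_minus_def)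
      \<comment> \<open>Substituting - g^-1 x for the argument of 1 - g turns it into x - g^-1
        x.\<close>
      then have "u = - inv_into UNIV g x - g (- inv_into UNIV g x)"
        by (simp add: lin inv)
      then show "u \<in> image_one_minus g"
        unfolding image_one_minus_def by blast
    next
      fix u assume "u \<in> image_one_minus g"
      then obtain x where "u = x - g x"
        by (auto simp: image_one_minus_def)
      then have "u = g (- x) - inv_into UNIV g (g (- x))"
        unfolding inv by (simp add: lin)
      then show "u \<in> image_one_minus (inv_into UNIV g)"
        unfolding image_one_minus_def by blast
    qed
    then have "\<mu> (inv_into UNIV g) = \<mu> g"
      by (simp only: mu i)
    moreover have "\<eta>' (\<mu> g) = \<mu> g"
      unfolding mu using \<eta>' by (intro field_automorphism_of_nat_powi) blast
    ultimately show "\<mu> g = \<eta>' (\<mu> (inv\<^bsub>isometry_group scale f\<^esub> g))"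
      by (simp add: inv_isometry_group[OF V.vector_space_axioms g])
  qed
qed

end
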